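(* Let $N\ge2$. Let $d(s)$ be a real monic polynomial of degree $N$ whose zeros $\delta_1,\dots,\delta_N$ are distinct and lie in the open left half plane, and let $e(s)$ be a real polynomial of degree at most $N-1$, coprime to $d$, so that $e/d\in\Sigma S_N$. Let $$M=\mathrm{diag}(e(\delta_1),\dots,e(\delta_N))\,V(\delta_1,\dots,\delta_N)\,V(-\delta_1,\dots,-\delta_N)^{-1},$$ and let $\Xi$ be the set of $x\in\mathbb{C}^N\setminus\{0\}$ satisfying $x_i^2=(Mx)_i$ for $i=1,\dots,N$. (i) The number of critical points of the function $f:\Sigma S_{N-1}\to[0,\infty)$, $f(b/a)=\|e/d-b/a\|_2^2$, is finite and at most $2^N-1$. (ii) If $b/a\in\Sigma S_{N-1}$ (with $a$ monic) is a critical point of $f$, then there exist a number $q_0$ and a vector $\xi\in\Xi$ such that $q_0a(-\delta_i)=\xi_i$ for $i=1,\dots,N$. For given $q_0$ and $\xi$, the polynomial $a$ is uniquely determined by this linear system, and $b$ is uniquely determined by $b(s)=\bigl(e(s)a(s)-q_0a(-s)^2\bigr)/d(s)$.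
   Context: $V(\delta_1,\dots,\delta_N)$ is the $N\times N$ Vandermonde matrix whose $i$-th row is $(1,\delta_i,\delta_i^2,\dots,\delta_i^{N-1})$. For $n\ge1$, $\Sigma S_n$ denotes the set (a differentiable manifold) of real rational functions $b(s)/a(s)$ with $a,b$ real coprime polynomials, $a$ a monic Hurwitz polynomial (all zeros in the open left half plane) of degree $n$ and $\deg b<n$. For such strictly proper stable rational functions $t$, $\|t\|_2^2=\frac{1}{2\pi}\int_{-\infty}^{\infty}|t(i\omega)|^2\,d\omega$ (the $H_2$ norm). A critical point of $f$ is a point of the manifold $\Sigma S_{N-1}$ where the differential of $f$ vanishes. *)

theory Defs
  imports "HOL-Analysis.Analysis" "HOL-Computational_Algebra.Polynomial"
    "Jordan_Normal_Form.Gauss_Jordan_Elimination"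
begin

abbreviation cpoly :: "real poly \<Rightarrow> complex poly" where
  "cpoly p \<equiv> map_poly complex_of_real p"

definition hurwitz :: "real poly \<Rightarrow> bool" where
  "hurwitz a \<longleftrightarrow> (\<forall>z. poly (cpoly a) z = 0 \<longrightarrow> Re z < 0)"

text \<open>The pair (a,b) represents the element b/a of Sigma S_n
  (a monic Hurwitz of degree n, deg b < n, a and b coprime).\<close>
definition SigmaS :: "nat \<Rightarrow> real poly \<Rightarrow> real poly \<Rightarrow> bool" where
  "SigmaS n a b \<longleftrightarrow> lead_coeff a = 1 \<and> degree a = n \<and> hurwitz a \<and>
     degree b < n \<and> coprime a b"

definition rat_at_iw :: "real poly \<Rightarrow> real poly \<Rightarrow> real \<Rightarrow> complex" where
  "rat_at_iw b a w = poly (cpoly b) (\<i> * of_real w) / poly (cpoly a) (\<i> * of_real w)"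

definition H2_err_sq :: "real poly \<Rightarrow> real poly \<Rightarrow> real poly \<Rightarrow> real poly \<Rightarrow> real" where
  "H2_err_sq e d b a =
     (1 / (2 * pi)) * (LINT w|lborel. (cmod (rat_at_iw e d w - rat_at_iw b a w))\<^sup>2)"

definition coeff_norm :: "real poly \<Rightarrow> real" where
  "coeff_norm p = (\<Sum>i\<le>degree p. \<bar>coeff p i\<bar>)"

text \<open>Critical point of F(b/a) on Sigma S_n: the differential of F vanishes in the
  global coefficient chart (lower coefficients of a, coefficients of b), i.e.
  F has zero Frechet derivative there.\<close>
definition critical_point ::
  "(real poly \<Rightarrow> real poly \<Rightarrow> real) \<Rightarrow> nat \<Rightarrow> real poly \<Rightarrow> real poly \<Rightarrow> bool" where
  "critical_point F n b a \<longleftrightarrow> SigmaS n a b \<and>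
     (\<forall>\<epsilon>>0. \<exists>\<delta>>0. \<forall>\<alpha> \<beta>. degree \<alpha> < n \<longrightarrow> degree \<beta> < n \<longrightarrow>
        coeff_norm \<alpha> + coeff_norm \<beta> < \<delta> \<longrightarrow>
        \<bar>F (b + \<beta>) (a + \<alpha>) - F b a\<bar> \<le> \<epsilon> * (coeff_norm \<alpha> + coeff_norm \<beta>))"

definition vandermonde :: "nat \<Rightarrow> (nat \<Rightarrow> complex) \<Rightarrow> complex mat" where
  "vandermonde N x = mat N N (\<lambda>(i,j). x i ^ j)"

definition Mmat :: "nat \<Rightarrow> (nat \<Rightarrow> complex) \<Rightarrow> real poly \<Rightarrow> complex mat" where
  "Mmat N \<delta> e =
     mat N N (\<lambda>(i,j). if i = j then poly (cpoly e) (\<delta> i) else 0)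
     * vandermonde N \<delta> * the (mat_inverse (vandermonde N (\<lambda>i. - \<delta> i)))"

definition Xi :: "nat \<Rightarrow> (nat \<Rightarrow> complex) \<Rightarrow> real poly \<Rightarrow> complex vec set" where
  "Xi N \<delta> e = {x. x \<in> carrier_vec N \<and> x \<noteq> 0\<^sub>v N \<and>
      (\<forall>i<N. (x $ i)\<^sup>2 = (Mmat N \<delta> e *\<^sub>v x) $ i)}"

end

theory Submission
  imports Defs
    "HOL-Complex_Analysis.Cauchy_Integral_Theorem"
    "HOL-Probability.Sinc_Integral"
    "HOL-Computational_Algebra.Field_as_Ring"
    "HOL-Computational_Algebra.Fundamental_Theorem_Algebra"
    "Jordan_Normal_Form.Char_Poly"
begin

text \<open>
  The tangent vectors of \<^term>\<open>SigmaS n\<close> at b/a are, by coprimality, all the fractions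
  p/a^2 with deg p < 2n. So at a critical point the error r/(da), where r = ea - bd, is
  orthogonal to each of them. Write a* for a(-s) and decompose r a^2 = h a*^2 + p d a with
  deg p < 2n. Then r/(da) = p/a^2 + (a*/a)^2 h/(da), and the second summand is orthogonal to
  p/a^2 by Cauchy's theorem in the right half plane. Hence p = 0, so a*^2 divides r, and
  comparing degrees gives ea - bd = q0 a*^2. Evaluating at the zeros of d turns this into the
  quadratic system defining \<^const>\<open>Xi\<close>. The linear relations between the values of the 2^N
  square-free monomials at finitely many solutions of that system are closed under
  multiplication by the coordinates. As the coordinates separate points, every such relation
  is trivial, so the system has at most 2^N solutions, one of which is 0.
\<close>

section \<open>Rational functions on the closed right half plane\<close>

lemma norm_linear_mult_add_le_on_closed:
  fixes q h :: "'a \<Rightarrow> 'a::{real_normed_field, heine_borel}"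
  assumes "closed S" and "z \<notin> S"
    and q: "\<And>s. s \<in> S \<Longrightarrow> norm (q s) \<le> C\<^sub>1 * norm (h s)"
    and c: "\<And>s. s \<in> S \<Longrightarrow> norm c \<le> C\<^sub>2 * norm (h s)"
  shows "\<exists>C. \<forall>s\<in>S. norm ((s - z) * q s + c) \<le> C * norm ((s - z) * h s)"
proof -
  obtain \<delta> where \<delta>: "0 < \<delta>" "\<And>s. s \<in> S \<Longrightarrow> \<delta> \<le> norm (s - z)"
    using separate_point_closed[OF assms(1,2)] by (metis dist_norm norm_minus_commute)
  have "norm ((s - z) * q s + c) \<le> (C\<^sub>1 + C\<^sub>2 / \<delta>) * norm ((s - z) * h s)" if s: "s \<in> S" for s
  proof -
    have "norm ((s - z) * q s + c) \<le> norm (s - z) * norm (q s) + norm c"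
      unfolding norm_mult[symmetric] by (rule norm_triangle_ineq)
    also have "\<dots> \<le> norm (s - z) * (C\<^sub>1 * norm (h s)) + norm (s - z) / \<delta> * (C\<^sub>2 * norm (h s))"
    proof (intro add_mono mult_left_mono)
      have "1 * norm c \<le> norm (s - z) / \<delta> * (C\<^sub>2 * norm (h s))"
        using \<delta>(1) \<delta>(2)[OF s] by (intro mult_mono c s) auto
      then show "norm c \<le> norm (s - z) / \<delta> * (C\<^sub>2 * norm (h s))" by simp
    qed (use q[OF s] in auto)
    also have "\<dots> = (C\<^sub>1 + C\<^sub>2 / \<delta>) * norm ((s - z) * h s)"
      unfolding norm_mult by (simp add: algebra_simps)
    finally show ?thesis .
  qed
  then show ?thesis by blast
qed

lemma poly_bounded_by_poly_on_closed:
  fixes P D :: "complex poly"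
  assumes "closed S" and "\<And>s. s \<in> S \<Longrightarrow> poly D s \<noteq> 0" and "degree P \<le> degree D"
  shows "\<exists>C. \<forall>s\<in>S. cmod (poly P s) \<le> C * cmod (poly D s)"
  using assms(2,3)
proof (induction "degree D" arbitrary: P D)
  case 0
  then obtain c p where "D = [:c:]" and "P = [:p:]"
    by (metis degree_eq_zeroE le_zero_eq)
  then show ?case
    using 0(2) by (intro exI[of _ "cmod p / cmod c"]) auto
next
  case (Suc n)
  then obtain z where z: "poly D z = 0"
    using fundamental_theorem_of_algebra[of D] by (auto simp: constant_degree)
  then obtain D' where D: "D = [:- z, 1:] * D'"
    by (metis dvdE poly_eq_0_iff_dvd)
  have D_eq: "poly D s = (s - z) * poly D' s" for s
    by (simp add: D algebra_simps)
  have "D' \<noteq> 0" using D Suc.hyps(2) by auto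
  then have deg_D': "degree D' = n"
    using D Suc.hyps(2) by (simp add: degree_mult_eq del: mult_pCons_left)
  have D'_nz: "poly D' s \<noteq> 0" if "s \<in> S" for s
    using Suc.prems(1)[OF that] by (simp add: D)
  define Q where "Q = synthetic_div P z"
  have P: "P = [:- z, 1:] * Q + [:poly P z:]"
    unfolding Q_def by (rule synthetic_div_correct'[symmetric])
  have P_eq: "poly P s = (s - z) * poly Q s + poly P z" for s
    using arg_cong[OF P, of "\<lambda>p. poly p s"] by (simp add: algebra_simps)
  have "degree Q \<le> n"
    using Suc by (simp add: Q_def degree_synthetic_div)
  then obtain C\<^sub>1 where "\<And>s. s \<in> S \<Longrightarrow> cmod (poly Q s) \<le> C\<^sub>1 * cmod (poly D' s)"
    using Suc.hyps(1)[of D' Q] deg_D' D'_nz by blast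
  moreover obtain C\<^sub>2 where "\<And>s. s \<in> S \<Longrightarrow> cmod (poly P z) \<le> C\<^sub>2 * cmod (poly D' s)"
    using Suc.hyps(1)[of D' "[:poly P z:]"] deg_D' D'_nz by auto
  moreover have "z \<notin> S" using Suc.prems(1) z by blast
  ultimately have "\<exists>C. \<forall>s\<in>S. cmod ((s - z) * poly Q s + poly P z) \<le> C * cmod ((s - z) * poly D' s)"
    by (rule norm_linear_mult_add_le_on_closed[OF assms(1), rotated])
  then show ?case unfolding P_eq[symmetric] D_eq[symmetric] .
qed

lemma rational_decay_right_half_plane:
  fixes P D :: "complex poly"
  assumes "\<And>s. 0 \<le> Re s \<Longrightarrow> poly D s \<noteq> 0" and "degree P + k \<le> degree D"
  shows "\<exists>C. \<forall>s. 0 \<le> Re s \<longrightarrow> cmod (poly P s / poly D s) \<le> C / (1 + cmod s ^ k)"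
proof -
  have "degree (P * monom 1 k) \<le> degree D"
    using assms(2) degree_mult_le[of P "monom 1 k"] by (simp add: degree_monom_eq)
  then obtain C\<^sub>1 C\<^sub>2 where
      C\<^sub>1: "\<And>s. 0 \<le> Re s \<Longrightarrow> cmod (poly P s) \<le> C\<^sub>1 * cmod (poly D s)" and
      C\<^sub>2: "\<And>s. 0 \<le> Re s \<Longrightarrow> cmod (poly (P * monom 1 k) s) \<le> C\<^sub>2 * cmod (poly D s)"
    using poly_bounded_by_poly_on_closed[of "{s. 0 \<le> Re s}" D] assms closed_halfspace_Re_ge
    by (metis add_leD1 mem_Collect_eq)
  have "cmod (poly P s / poly D s) \<le> (C\<^sub>1 + C\<^sub>2) / (1 + cmod s ^ k)" if s: "0 \<le> Re s" for s
  proof -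
    have "cmod (poly P s) * (1 + cmod s ^ k) \<le> (C\<^sub>1 + C\<^sub>2) * cmod (poly D s)"
      using C\<^sub>1[OF s] C\<^sub>2[OF s] by (simp add: poly_monom norm_mult norm_power algebra_simps)
    moreover have "0 < 1 + cmod s ^ k" by (simp add: add_pos_nonneg)
    ultimately show ?thesis
      using assms(1)[OF s] by (simp add: norm_divide field_simps)
  qed
  then show ?thesis by blast
qed

abbreviation right_semicircle :: "real \<Rightarrow> real \<Rightarrow> complex" where
  "right_semicircle R \<equiv> part_circlepath 0 R (- (pi / 2)) (pi / 2)"

lemma path_image_right_semicircle:
  assumes "0 < R" and "s \<in> path_image (right_semicircle R)"
  shows "0 \<le> Re s" and "cmod s = R"
  using assms
  by (auto simp: path_image_part_circlepath Re_exp norm_mult intro!: mult_nonneg_nonneg cos_ge_zero)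

lemma contour_integrable_right_semicircle:
  assumes "continuous_on {s. 0 \<le> Re s} f" and "0 < R"
  shows "f contour_integrable_on right_semicircle R"
  by (rule contour_integrable_continuous_part_circlepath, rule continuous_on_subset[OF assms(1)])
    (use path_image_right_semicircle[OF assms(2)] in auto)

lemma contour_integral_right_semicircle_eq_diameter:
  assumes cont: "continuous_on {s. 0 \<le> Re s} f" and holo: "f holomorphic_on {s. 0 < Re s}"
    and R: "0 < R"
  shows "(f has_contour_integral contour_integral (right_semicircle R) f)
    (linepath (Complex 0 (- R)) (Complex 0 R))"
proof -
  let ?H = "{s. 0 \<le> Re s}"
  define \<gamma> \<sigma> where "\<gamma> = right_semicircle R" and "\<sigma> = linepath (Complex 0 (- R)) (Complex 0 R)"
  have ends: "pathstart \<gamma> = pathstart \<sigma>" "pathfinish \<gamma> = pathfinish \<sigma>"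
    by (auto simp: \<gamma>_def \<sigma>_def complex_eq_iff Re_exp Im_exp)
  have valid: "valid_path \<gamma>" "valid_path \<sigma>"
    by (simp_all add: \<gamma>_def \<sigma>_def)
  have \<sigma>_H: "path_image \<sigma> \<subseteq> ?H"
    by (auto simp: \<sigma>_def closed_segment_same_Re)
  have \<gamma>_int: "f contour_integrable_on \<gamma>"
    unfolding \<gamma>_def using cont R by (rule contour_integrable_right_semicircle)
  have \<sigma>_int: "f contour_integrable_on \<sigma>"
    using continuous_on_subset[OF cont \<sigma>_H]
    by (auto simp: \<sigma>_def intro: contour_integrable_continuous_linepath)
  have int_H: "interior ?H = {s. 0 < Re s}"
    using interior_halfspace_ge[of "1 :: complex" 0] by simp
  have "(f has_contour_integral 0) (\<gamma> +++ reversepath \<sigma>)"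
  proof (rule Cauchy_theorem_convex[OF cont convex_halfspace_Re_ge finite.emptyI])
    show "f field_differentiable at s" if "s \<in> interior ?H - {}" for s
      using that holomorphic_on_imp_differentiable_at[OF holo open_halfspace_Re_gt] int_H by simp
    show "path_image (\<gamma> +++ reversepath \<sigma>) \<subseteq> ?H"
      using path_image_right_semicircle[OF R] \<sigma>_H ends by (auto simp: path_image_join \<gamma>_def)
  qed (use ends valid in auto)
  then have "contour_integral \<sigma> f = contour_integral \<gamma> f"
    using contour_integral_unique[of f 0 "\<gamma> +++ reversepath \<sigma>"] \<gamma>_int \<sigma>_int valid
    by (simp add: contour_integrable_reversepath contour_integral_reversepath)
  with has_contour_integral_integral[OF \<sigma>_int] show ?thesis
    by (simp add: \<gamma>_def \<sigma>_def)
qed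

lemma norm_integral_imaginary_segment_le:
  assumes cont: "continuous_on {s. 0 \<le> Re s} f" and holo: "f holomorphic_on {s. 0 < Re s}"
    and R: "0 < R" and bound: "\<And>s. 0 \<le> Re s \<Longrightarrow> cmod s = R \<Longrightarrow> cmod (f s) \<le> B"
  shows "cmod (integral {- R..R} (\<lambda>w. f (\<i> * of_real w))) \<le> B * R * pi"
proof -
  let ?I = "contour_integral (right_semicircle R) f"
  have "integral {- R..R} (\<lambda>w. f (\<i> * of_real w)) = - \<i> * ?I"
    using contour_integral_right_semicircle_eq_diameter[OF cont holo R] R
    by (subst (asm) has_contour_integral_linepath_same_Re_iff[where c = 0 and a = "- R" and b = R])
      (auto simp: Complex_eq intro: integral_unique)
  moreover have "cmod ?I \<le> B * R * (pi / 2 - - (pi / 2))"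
  proof (rule has_contour_integral_bound_part_circlepath)
    show "(f has_contour_integral ?I) (right_semicircle R)"
      by (rule has_contour_integral_integral[OF contour_integrable_right_semicircle[OF cont R]])
    show "0 \<le> B"
      using bound[of "of_real R"] R by (auto intro: order_trans[OF norm_ge_zero])
  qed (use R path_image_right_semicircle[OF R] bound in auto)
  ultimately show ?thesis by (simp add: norm_mult)
qed

lemma tendsto_integral_symmetric_interval:
  fixes f :: "real \<Rightarrow> 'a::euclidean_space"
  assumes int: "integrable lborel f"
  shows "((\<lambda>R. integral {- R..R} f) \<longlongrightarrow> (LINT x|lborel. f x)) at_top"
proof -
  have "((\<lambda>R. LINT x|lborel. indicator {- R..R} x *\<^sub>R f x) \<longlongrightarrow> (LINT x|lborel. f x)) at_top"
  proof (rule integral_dominated_convergence_at_top[where w = "\<lambda>x. norm (f x)"])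
    show "AE x in lborel. ((\<lambda>R. indicator {- R..R} x *\<^sub>R f x) \<longlongrightarrow> f x) at_top"
    proof (intro AE_I2 tendsto_eventually)
      show "\<forall>\<^sub>F R in at_top. indicator {- R..R} x *\<^sub>R f x = f x" for x :: real
        using eventually_ge_at_top[of "\<bar>x\<bar>"] by eventually_elim (auto simp: indicator_def)
    qed
  qed (use int in \<open>auto simp: indicator_def\<close>)
  moreover have "(LINT x|lborel. indicator {- R..R} x *\<^sub>R f x) = integral {- R..R} f" for R
    using set_borel_integral_eq_integral(2)[of "{- R..R}" f] int
    by (simp add: set_lebesgue_integral_def set_integrable_def integrable_mult_indicator)
  ultimately show ?thesis by simp
qed

lemma integral_imaginary_axis_eq_0:
  assumes cont: "continuous_on {s. 0 \<le> Re s} f" and holo: "f holomorphic_on {s. 0 < Re s}"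
    and decay: "\<And>s. 0 \<le> Re s \<Longrightarrow> cmod (f s) \<le> C / (1 + (cmod s)\<^sup>2)"
  shows "integrable lborel (\<lambda>w. f (\<i> * of_real w))"
    and "(LINT w|lborel. f (\<i> * of_real w)) = 0"
proof -
  let ?h = "\<lambda>w. f (\<i> * of_real w)"
  have C: "0 \<le> C" using decay[of 0] by (auto intro: order_trans[OF norm_ge_zero])
  have "continuous_on UNIV ?h"
    by (rule continuous_on_compose2[OF cont]) (auto intro!: continuous_intros)
  then have [measurable]: "?h \<in> borel_measurable lborel"
    by (simp add: borel_measurable_continuous_onI)
  have "integrable lborel (\<lambda>w. C * inverse (1 + w\<^sup>2))"
    using integrable_inverse_1_plus_square by (simp add: set_integrable_def einterval_def)
  then show int: "integrable lborel ?h"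
    by (rule Bochner_Integration.integrable_bound)
      (use C decay[of "\<i> * of_real w" for w] in \<open>auto simp: divide_inverse norm_mult\<close>)
  have "((\<lambda>R. integral {- R..R} ?h) \<longlongrightarrow> 0) at_top"
  proof (rule Lim_null_comparison)
    show "\<forall>\<^sub>F R in at_top. cmod (integral {- R..R} ?h) \<le> C * pi * inverse R"
      using eventually_gt_at_top[of 0]
    proof eventually_elim
      case (elim R)
      have "cmod (integral {- R..R} ?h) \<le> C / (1 + R\<^sup>2) * R * pi"
        by (rule norm_integral_imaginary_segment_le[OF cont holo elim]) (use decay in auto)
      also have "\<dots> \<le> C / R\<^sup>2 * R * pi"
        using C elim by (intro mult_right_mono divide_left_mono) (auto simp: add_pos_nonneg)
      finally show ?case using elim by (simp add: power2_eq_square field_simps)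
    qed
    show "((\<lambda>R. C * pi * inverse R) \<longlongrightarrow> 0) at_top"
      by (intro tendsto_mult_right_zero tendsto_inverse_0_at_top filterlim_ident)
  qed
  with tendsto_integral_symmetric_interval[OF int] show "(LINT w|lborel. ?h w) = 0"
    by (rule tendsto_unique[OF trivial_limit_at_top_linorder])
qed

lemma integral_rational_imaginary_axis_eq_0:
  fixes P D :: "complex poly"
  assumes "\<And>s. 0 \<le> Re s \<Longrightarrow> poly D s \<noteq> 0" and "degree P + 2 \<le> degree D"
  shows "integrable lborel (\<lambda>w. poly P (\<i> * of_real w) / poly D (\<i> * of_real w))"
    and "(LINT w|lborel. poly P (\<i> * of_real w) / poly D (\<i> * of_real w)) = 0"
proof -
  let ?f = "\<lambda>s. poly P s / poly D s"
  obtain C where C: "\<And>s. 0 \<le> Re s \<Longrightarrow> cmod (?f s) \<le> C / (1 + (cmod s)\<^sup>2)"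
    using rational_decay_right_half_plane[OF assms] by blast
  have cont: "continuous_on {s. 0 \<le> Re s} ?f" and holo: "?f holomorphic_on {s. 0 < Re s}"
    using assms(1) by (auto intro!: continuous_intros holomorphic_intros)
  show "integrable lborel (\<lambda>w. ?f (\<i> * of_real w))" "(LINT w|lborel. ?f (\<i> * of_real w)) = 0"
    using integral_imaginary_axis_eq_0[OF cont holo C] by auto
qed

section \<open>Differentiating squared L2 norms\<close>

definition square_integrable :: "'a measure \<Rightarrow> ('a \<Rightarrow> 'b::real_normed_vector) \<Rightarrow> bool" where
  "square_integrable M f \<longleftrightarrow> f \<in> borel_measurable M \<and> integrable M (\<lambda>x. (norm (f x))\<^sup>2)"

lemma square_integrable_norm_mult:
  fixes f :: "'a \<Rightarrow> 'b::{real_normed_vector, second_countable_topology}"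
    and g :: "'a \<Rightarrow> 'c::{real_normed_vector, second_countable_topology}"
  assumes "square_integrable M f" and "square_integrable M g"
  shows "integrable M (\<lambda>x. norm (f x) * norm (g x))"
proof (rule Bochner_Integration.integrable_bound)
  have [measurable]: "f \<in> borel_measurable M" "g \<in> borel_measurable M"
    using assms by (auto simp: square_integrable_def)
  show "(\<lambda>x. norm (f x) * norm (g x)) \<in> borel_measurable M" by measurable
  show "integrable M (\<lambda>x. (norm (f x))\<^sup>2 + (norm (g x))\<^sup>2)"
    using assms by (simp add: square_integrable_def)
  have "norm (f x) * norm (g x) \<le> (norm (f x))\<^sup>2 + (norm (g x))\<^sup>2" for x
    using sum_squares_bound[of "norm (f x)" "norm (g x)"]
      mult_nonneg_nonneg[OF norm_ge_zero norm_ge_zero, of "f x" "g x"] by linarith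
  then show "AE x in M. norm (norm (f x) * norm (g x)) \<le> norm ((norm (f x))\<^sup>2 + (norm (g x))\<^sup>2)"
    by simp
qed

lemma square_integrable_diff:
  fixes f g :: "'a \<Rightarrow> 'b::{real_normed_vector, second_countable_topology}"
  assumes "square_integrable M f" and "square_integrable M g"
  shows "square_integrable M (\<lambda>x. f x - g x)"
  unfolding square_integrable_def
proof (intro conjI)
  have [measurable]: "f \<in> borel_measurable M" "g \<in> borel_measurable M"
    using assms by (auto simp: square_integrable_def)
  show "(\<lambda>x. f x - g x) \<in> borel_measurable M" by measurable
  have "integrable M (\<lambda>x. (norm (f x))\<^sup>2 + 2 * (norm (f x) * norm (g x)) + (norm (g x))\<^sup>2)"
    using assms square_integrable_norm_mult[OF assms] by (simp add: square_integrable_def)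
  then show "integrable M (\<lambda>x. (norm (f x - g x))\<^sup>2)"
  proof (rule Bochner_Integration.integrable_bound)
    have "(norm (f x - g x))\<^sup>2
        \<le> (norm (f x))\<^sup>2 + 2 * (norm (f x) * norm (g x)) + (norm (g x))\<^sup>2" for x
      using power_mono[OF norm_triangle_ineq4 norm_ge_zero, of "f x" "g x" 2]
      by (simp add: power2_sum algebra_simps)
    then show "AE x in M. norm ((norm (f x - g x))\<^sup>2)
        \<le> norm ((norm (f x))\<^sup>2 + 2 * (norm (f x) * norm (g x)) + (norm (g x))\<^sup>2)"
      by (intro AE_I2) (simp add: order_trans[OF _ abs_ge_self])
  qed measurable
qed

lemma tendsto_integral_dominated_at:
  fixes F :: "'c::metric_space \<Rightarrow> 'a \<Rightarrow> 'b::{banach, second_countable_topology}"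
  assumes meas: "\<And>t. F t \<in> borel_measurable M" and G: "G \<in> borel_measurable M"
    and lim: "\<And>x. x \<in> space M \<Longrightarrow> ((\<lambda>t. F t x) \<longlongrightarrow> G x) (at t\<^sub>0)"
    and B: "integrable M B" and r: "0 < r"
    and bound: "\<And>t x. t \<noteq> t\<^sub>0 \<Longrightarrow> dist t\<^sub>0 t < r \<Longrightarrow> x \<in> space M \<Longrightarrow> norm (F t x) \<le> B x"
  shows "((\<lambda>t. \<integral>x. F t x \<partial>M) \<longlongrightarrow> (\<integral>x. G x \<partial>M)) (at t\<^sub>0)"
proof -
  have at_eq: "at t\<^sub>0 = at t\<^sub>0 within ball t\<^sub>0 r"
    by (rule at_within_open[symmetric]) (use r in auto)
  have "(\<lambda>n. \<integral>x. F (X n) x \<partial>M) \<longlonglongrightarrow> (\<integral>x. G x \<partial>M)"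
    if X: "\<And>n. X n \<in> ball t\<^sub>0 r - {t\<^sub>0}" "X \<longlonglongrightarrow> t\<^sub>0" for X
  proof (rule integral_dominated_convergence[OF G meas B])
    show "AE x in M. (\<lambda>n. F (X n) x) \<longlonglongrightarrow> G x"
      using lim X unfolding at_eq tendsto_at_iff_sequentially by (auto simp: o_def)
    show "AE x in M. norm (F (X n) x) \<le> B x" for n
      using bound X(1)[of n] by auto
  qed
  then show ?thesis
    by (subst at_eq) (auto simp: tendsto_at_iff_sequentially o_def)
qed

lemma has_real_derivative_integral_dominated:
  fixes F :: "real \<Rightarrow> 'a \<Rightarrow> real"
  assumes meas: "\<And>t. F t \<in> borel_measurable M" "F' \<in> borel_measurable M"
    and int: "integrable M (F t\<^sub>0)" and B: "integrable M B" and r: "0 < r"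
    and deriv: "\<And>x. x \<in> space M \<Longrightarrow> ((\<lambda>t. F t x) has_real_derivative F' x) (at t\<^sub>0)"
    and bound: "\<And>t x. \<bar>t - t\<^sub>0\<bar> < r \<Longrightarrow> x \<in> space M \<Longrightarrow> \<bar>F t x - F t\<^sub>0 x\<bar> \<le> \<bar>t - t\<^sub>0\<bar> * B x"
  shows "((\<lambda>t. \<integral>x. F t x \<partial>M) has_real_derivative (\<integral>x. F' x \<partial>M)) (at t\<^sub>0)"
proof -
  have diff_int: "integrable M (\<lambda>x. F t x - F t\<^sub>0 x)" if "\<bar>t - t\<^sub>0\<bar> < r" for t
  proof (rule Bochner_Integration.integrable_bound)
    show "integrable M (\<lambda>x. \<bar>t - t\<^sub>0\<bar> * B x)" using B by simp
    show "(\<lambda>x. F t x - F t\<^sub>0 x) \<in> borel_measurable M" using meas(1) by measurable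
  qed (use bound[OF that] in \<open>auto intro!: AE_I2 order_trans[OF _ abs_ge_self]\<close>)
  have "((\<lambda>t. \<integral>x. (F t x - F t\<^sub>0 x) / (t - t\<^sub>0) \<partial>M) \<longlongrightarrow> (\<integral>x. F' x \<partial>M)) (at t\<^sub>0)"
  proof (rule tendsto_integral_dominated_at[OF _ meas(2) _ B r])
    show "(\<lambda>x. (F t x - F t\<^sub>0 x) / (t - t\<^sub>0)) \<in> borel_measurable M" for t
      using meas(1) by measurable
    fix x assume x: "x \<in> space M"
    show "((\<lambda>t. (F t x - F t\<^sub>0 x) / (t - t\<^sub>0)) \<longlongrightarrow> F' x) (at t\<^sub>0)"
      using deriv[OF x] by (simp add: has_field_derivative_iff)
    show "norm ((F t x - F t\<^sub>0 x) / (t - t\<^sub>0)) \<le> B x" if "t \<noteq> t\<^sub>0" "dist t\<^sub>0 t < r" for t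
      using bound[of t x] x that by (simp add: dist_real_def abs_minus_commute field_simps)
  qed
  moreover have "\<forall>\<^sub>F t in at t\<^sub>0. (\<integral>x. (F t x - F t\<^sub>0 x) / (t - t\<^sub>0) \<partial>M)
      = ((\<integral>x. F t x \<partial>M) - (\<integral>x. F t\<^sub>0 x \<partial>M)) / (t - t\<^sub>0)"
    unfolding eventually_at
  proof (intro exI[of _ r] conjI r ballI impI)
    fix t assume "t \<noteq> t\<^sub>0 \<and> dist t t\<^sub>0 < r"
    then have "integrable M (\<lambda>x. F t x - F t\<^sub>0 x)" by (intro diff_int) (simp add: dist_real_def)
    with int have "integrable M (F t)"
      using Bochner_Integration.integrable_add[of M "\<lambda>x. F t x - F t\<^sub>0 x" "F t\<^sub>0"] by simp
    with int show "(\<integral>x. (F t x - F t\<^sub>0 x) / (t - t\<^sub>0) \<partial>M)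
        = ((\<integral>x. F t x \<partial>M) - (\<integral>x. F t\<^sub>0 x \<partial>M)) / (t - t\<^sub>0)" by simp
  qed
  ultimately show ?thesis
    unfolding has_field_derivative_iff by (rule Lim_transform_eventually)
qed

lemma abs_norm_squared_diff_le:
  fixes x y :: "'a::real_inner"
  assumes "norm (x - y) \<le> \<delta>"
  shows "\<bar>(norm x)\<^sup>2 - (norm y)\<^sup>2\<bar> \<le> \<delta> * (2 * norm y + \<delta>)"
proof -
  have "(norm x)\<^sup>2 - (norm y)\<^sup>2 = (x - y) \<bullet> (x + y)"
    by (simp add: power2_norm_eq_inner inner_add inner_diff inner_commute)
  also have "\<bar>\<dots>\<bar> \<le> norm (x - y) * norm (x + y)"
    by (rule Cauchy_Schwarz_ineq2)
  also have "\<dots> \<le> \<delta> * (2 * norm y + \<delta>)"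
  proof (intro mult_mono assms)
    show "norm (x + y) \<le> 2 * norm y + \<delta>"
      using norm_triangle_ineq[of "y + y" "x - y"] norm_triangle_ineq[of y y] assms
      by (simp add: add.commute)
  qed (use order_trans[OF norm_ge_zero assms] in auto)
  finally show ?thesis .
qed

lemma has_real_derivative_L2_norm_squared:
  fixes u :: "real \<Rightarrow> 'a \<Rightarrow> 'b::{real_inner, second_countable_topology}" and g :: "'a \<Rightarrow> real"
  assumes meas: "\<And>t. u t \<in> borel_measurable M" "u' \<in> borel_measurable M"
    and u: "square_integrable M (u t\<^sub>0)" and g: "square_integrable M g"
    and deriv: "\<And>x. x \<in> space M \<Longrightarrow> ((\<lambda>t. u t x) has_vector_derivative u' x) (at t\<^sub>0)"
    and r: "0 < r"
    and bound: "\<And>t x. \<bar>t - t\<^sub>0\<bar> < r \<Longrightarrow> x \<in> space M \<Longrightarrow> norm (u t x - u t\<^sub>0 x) \<le> \<bar>t - t\<^sub>0\<bar> * g x"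
  shows "((\<lambda>t. \<integral>x. (norm (u t x))\<^sup>2 \<partial>M) has_real_derivative 2 * (\<integral>x. u t\<^sub>0 x \<bullet> u' x \<partial>M)) (at t\<^sub>0)"
proof -
  have "((\<lambda>t. \<integral>x. (norm (u t x))\<^sup>2 \<partial>M) has_real_derivative (\<integral>x. 2 * (u t\<^sub>0 x \<bullet> u' x) \<partial>M)) (at t\<^sub>0)"
  proof (rule has_real_derivative_integral_dominated[OF _ _ _ _ r])
    show "(\<lambda>x. (norm (u t x))\<^sup>2) \<in> borel_measurable M"
      and "(\<lambda>x. 2 * (u t\<^sub>0 x \<bullet> u' x)) \<in> borel_measurable M" for t
      using meas by measurable
    show "integrable M (\<lambda>x. (norm (u t\<^sub>0 x))\<^sup>2)"
      using u by (simp add: square_integrable_def)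
    show "integrable M (\<lambda>x. 2 * (norm (u t\<^sub>0 x) * norm (g x)) + r * (norm (g x))\<^sup>2)"
      using square_integrable_norm_mult[OF u g] g by (simp add: square_integrable_def)
    fix x assume x: "x \<in> space M"
    show "((\<lambda>t. (norm (u t x))\<^sup>2) has_real_derivative 2 * (u t\<^sub>0 x \<bullet> u' x)) (at t\<^sub>0)"
      unfolding power2_norm_eq_inner has_real_derivative_iff_has_vector_derivative
      using bounded_bilinear.has_vector_derivative[OF bounded_bilinear_inner deriv deriv, OF x x]
      by (simp add: inner_commute)
    fix t assume t: "\<bar>t - t\<^sub>0\<bar> < r"
    have "norm (u t x - u t\<^sub>0 x) \<le> \<bar>t - t\<^sub>0\<bar> * norm (g x)"
      using bound[OF t x] by (rule order_trans) (simp add: mult_left_mono)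
    then have "\<bar>(norm (u t x))\<^sup>2 - (norm (u t\<^sub>0 x))\<^sup>2\<bar>
        \<le> \<bar>t - t\<^sub>0\<bar> * norm (g x) * (2 * norm (u t\<^sub>0 x) + \<bar>t - t\<^sub>0\<bar> * norm (g x))"
      by (rule abs_norm_squared_diff_le)
    also have "\<dots> \<le> \<bar>t - t\<^sub>0\<bar> * norm (g x) * (2 * norm (u t\<^sub>0 x) + r * norm (g x))"
      using t by (intro mult_left_mono add_left_mono mult_right_mono) auto
    also have "\<dots> = \<bar>t - t\<^sub>0\<bar> * (2 * (norm (u t\<^sub>0 x) * norm (g x)) + r * (norm (g x))\<^sup>2)"
      by (simp only: power2_eq_square algebra_simps)
    finally show "\<bar>(norm (u t x))\<^sup>2 - (norm (u t\<^sub>0 x))\<^sup>2\<bar>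
        \<le> \<bar>t - t\<^sub>0\<bar> * (2 * (norm (u t\<^sub>0 x) * norm (g x)) + r * (norm (g x))\<^sup>2)" .
  qed
  then show ?thesis by simp
qed

section \<open>Real polynomials on the imaginary axis\<close>

interpretation cpoly: map_poly_inj_idom_hom complex_of_real ..

abbreviation (input) mirror_poly :: "real poly \<Rightarrow> real poly" where
  "mirror_poly p \<equiv> p \<circ>\<^sub>p [:0, - 1:]"

lemma poly_cpoly_cnj: "poly (cpoly p) (cnj z) = cnj (poly (cpoly p) z)"
  by (rule poly_cnj_real[symmetric]) simp

lemma poly_cpoly_mirror: "poly (cpoly (mirror_poly p)) z = poly (cpoly p) (- z)"
  by (simp add: of_real_hom.map_poly_pcompose poly_pcompose hom_distribs)

lemma poly_cpoly_mirror_iw: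
  "poly (cpoly (mirror_poly p)) (\<i> * of_real w) = cnj (poly (cpoly p) (\<i> * of_real w))"
  by (simp add: poly_cpoly_mirror flip: poly_cpoly_cnj)

lemma degree_mirror_poly: "degree (mirror_poly p) = degree p"
  by (simp add: degree_pcompose)

lemma hurwitz_mult: "hurwitz a \<Longrightarrow> hurwitz b \<Longrightarrow> hurwitz (a * b)"
  by (auto simp: hurwitz_def cpoly.hom_mult)

lemma hurwitz_power: "hurwitz a \<Longrightarrow> hurwitz (a ^ n)"
  by (auto simp: hurwitz_def cpoly.hom_power)

lemma hurwitz_poly_nonzero: "hurwitz a \<Longrightarrow> 0 \<le> Re s \<Longrightarrow> poly (cpoly a) s \<noteq> 0"
  by (force simp: hurwitz_def)

lemma hurwitz_nonzero: "hurwitz a \<Longrightarrow> a \<noteq> 0"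
  using hurwitz_poly_nonzero[of a 0] by auto

lemma coprime_hurwitz_mirror:
  assumes "hurwitz a" and "hurwitz c"
  shows "coprime (mirror_poly a) c"
proof (rule coprimeI)
  fix g assume g: "g dvd mirror_poly a" "g dvd c"
  have "degree g = 0"
  proof (rule ccontr)
    assume "degree g \<noteq> 0"
    then obtain z where z: "poly (cpoly g) z = 0"
      using fundamental_theorem_of_algebra[of "cpoly g"] by (auto simp: constant_degree)
    then have "poly (cpoly c) z = 0" "poly (cpoly a) (- z) = 0"
      using g unfolding poly_cpoly_mirror[symmetric] by (auto simp: dvd_def cpoly.hom_mult)
    then have "Re z < 0" "Re (- z) < 0"
      using assms unfolding hurwitz_def by blast+
    then show False by simp
  qed
  moreover have "g \<noteq> 0"
    using g(2) hurwitz_nonzero[OF assms(2)] by auto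
  ultimately show "is_unit g" by (simp add: is_unit_iff_degree)
qed

lemma coprime_poly_decomposition:
  fixes a b p :: "'a::field_gcd poly"
  assumes "coprime a b" and "0 < degree a" and "0 < m"
    and "degree b \<le> m" and "degree p < degree a + m"
  obtains x y where "p = x * a + y * b" "degree x < m" "degree y < degree a"
proof -
  obtain u v where uv: "u * a + v * b = 1"
    using assms(1) bezout_coefficients_fst_snd[of a b] by auto
  define y where "y = (p * v) mod a"
  define x where "x = p * u + (p * v div a) * b"
  have "x * a + y * b = p * (u * a) + (p * v div a * a + y) * b"
    by (simp add: x_def algebra_simps)
  also have "p * v div a * a + y = p * v" by (simp add: y_def)
  also have "p * (u * a) + p * v * b = p * (u * a + v * b)" by (simp add: algebra_simps)
  finally have eq: "p = x * a + y * b" using uv by simp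
  have deg_y: "degree y < degree a"
    unfolding y_def using assms(2) degree_mod_less[of a "p * v"] by fastforce
  then have "degree (y * b) < degree a + m"
    using degree_mult_le[of y b] assms(4) by linarith
  then have "degree (p - y * b) < degree a + m"
    using assms(5) by (rule degree_diff_less[rotated])
  then have deg_xa: "degree (x * a) < degree a + m" by (simp add: eq)
  have "degree x < m"
  proof (cases "x = 0")
    case False
    moreover have "a \<noteq> 0" using assms(2) by auto
    ultimately show ?thesis using deg_xa by (simp add: degree_mult_eq)
  qed (use assms(3) in simp)
  with that eq deg_y show ?thesis by blast
qed

lemma borel_measurable_rat_at_iw [measurable]: "rat_at_iw b a \<in> borel_measurable borel"
proof -
  have "(\<lambda>w. poly (cpoly p) (\<i> * of_real w)) \<in> borel_measurable borel" for p
    by (intro borel_measurable_continuous_onI continuous_intros)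
  then show ?thesis
    unfolding rat_at_iw_def[abs_def] by measurable
qed

lemma integral_rat_at_iw_eq_0:
  assumes "hurwitz a" and "degree b + 2 \<le> degree a"
  shows "integrable lborel (rat_at_iw b a)" and "(LINT w|lborel. rat_at_iw b a w) = 0"
  using integral_rational_imaginary_axis_eq_0[of "cpoly a" "cpoly b"] hurwitz_poly_nonzero assms
  by (simp_all add: rat_at_iw_def[abs_def])

lemma square_integrable_rat_at_iw:
  assumes "hurwitz a" and "degree b < degree a"
  shows "square_integrable lborel (rat_at_iw b a)"
proof -
  have "integrable lborel (rat_at_iw (b\<^sup>2) (a\<^sup>2))"
    using assms degree_power_le[of b 2]
    by (intro integral_rat_at_iw_eq_0 hurwitz_power) (auto simp: degree_power_eq hurwitz_nonzero)
  then have "integrable lborel (\<lambda>w. cmod (rat_at_iw (b\<^sup>2) (a\<^sup>2) w))"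
    by (rule integrable_norm)
  moreover have "cmod (rat_at_iw (b\<^sup>2) (a\<^sup>2) w) = (cmod (rat_at_iw b a w))\<^sup>2" for w
    by (simp add: rat_at_iw_def cpoly.hom_power norm_divide norm_power power_divide)
  ultimately show ?thesis by (simp add: square_integrable_def)
qed

lemma rat_at_iw_L2_norm_eq_0D:
  assumes a: "hurwitz a" and deg: "degree b < degree a"
    and zero: "(LINT w|lborel. (cmod (rat_at_iw b a w))\<^sup>2) = 0"
  shows "b = 0"
proof (rule ccontr)
  assume "b \<noteq> 0"
  then have "finite {z. poly (cpoly b) z = 0}"
    by (intro poly_roots_finite) simp
  then have "finite ((\<lambda>w::real. \<i> * of_real w) -` {z. poly (cpoly b) z = 0})"
    by (rule finite_vimageI) (auto simp: inj_def)
  then have "AE w in lborel. w \<notin> (\<lambda>w::real. \<i> * of_real w) -` {z. poly (cpoly b) z = 0}"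
    by (intro AE_not_in finite_imp_null_set_lborel)
  moreover have "AE w in lborel. rat_at_iw b a w = 0"
    using zero square_integrable_rat_at_iw[OF a deg]
    by (simp add: square_integrable_def integral_nonneg_eq_0_iff_AE)
  ultimately have "AE w in (lborel :: real measure). False"
    by eventually_elim (use hurwitz_poly_nonzero[OF a] in \<open>auto simp: rat_at_iw_def\<close>)
  then have "emeasure (lborel :: real measure) UNIV = 0"
    by (simp add: AE_iff_measurable[OF _ refl])
  then show False by simp
qed

section \<open>Critical points of the H2 error\<close>

lemma coeff_norm_nonneg: "coeff_norm p \<ge> 0"
  by (simp add: coeff_norm_def sum_nonneg)

lemma coeff_norm_smult: "coeff_norm (Polynomial.smult t p) = \<bar>t\<bar> * coeff_norm p"
  by (cases "t = 0") (simp_all add: coeff_norm_def abs_mult sum_distrib_left)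

lemma critical_point_directional_derivative_eq_0:
  assumes crit: "critical_point F n b a" and deg: "degree \<alpha> < n" "degree \<beta> < n"
    and deriv: "((\<lambda>t. F (b + Polynomial.smult t \<beta>) (a + Polynomial.smult t \<alpha>))
      has_real_derivative D) (at 0)"
  shows "D = 0"
proof -
  let ?G = "\<lambda>t. F (b + Polynomial.smult t \<beta>) (a + Polynomial.smult t \<alpha>)"
  define K where "K = coeff_norm \<alpha> + coeff_norm \<beta>"
  have K: "0 \<le> K" by (simp add: K_def coeff_norm_nonneg)
  have "(\<lambda>h. (?G (0 + h) - ?G 0) / h) \<midarrow>0\<rightarrow> 0"
  proof (rule LIM_I)
    fix \<epsilon> :: real assume "0 < \<epsilon>"
    then have "0 < \<epsilon> / (K + 1)" using K by simp
    then obtain \<delta> where \<delta>: "0 < \<delta>" and small: "\<And>\<alpha> \<beta>. degree \<alpha> < n \<Longrightarrow> degree \<beta> < n \<Longrightarrow>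
        coeff_norm \<alpha> + coeff_norm \<beta> < \<delta> \<Longrightarrow>
        \<bar>F (b + \<beta>) (a + \<alpha>) - F b a\<bar> \<le> \<epsilon> / (K + 1) * (coeff_norm \<alpha> + coeff_norm \<beta>)"
      using crit unfolding critical_point_def by meson
    have "\<bar>(?G h - ?G 0) / h\<bar> < \<epsilon>" if h: "h \<noteq> 0" "\<bar>h\<bar> < \<delta> / (K + 1)" for h
    proof -
      have norm: "coeff_norm (Polynomial.smult h \<alpha>) + coeff_norm (Polynomial.smult h \<beta>) = \<bar>h\<bar> * K"
        by (simp add: K_def coeff_norm_smult algebra_simps)
      have "\<bar>h\<bar> * K \<le> \<bar>h\<bar> * (K + 1)" by (simp add: mult_left_mono)
      also have "\<dots> < \<delta>" using h(2) K by (simp add: field_simps)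
      finally have "\<bar>?G h - ?G 0\<bar> \<le> \<epsilon> / (K + 1) * (\<bar>h\<bar> * K)"
        using small[of "Polynomial.smult h \<alpha>" "Polynomial.smult h \<beta>"] deg h(1) by (simp add: norm)
      also have "\<dots> < \<epsilon> * \<bar>h\<bar>"
        using \<open>0 < \<epsilon>\<close> K h(1) by (simp add: field_simps)
      finally show ?thesis using h(1) by (simp add: field_simps)
    qed
    then show "\<exists>s>0. \<forall>h. h \<noteq> 0 \<and> norm (h - 0) < s \<longrightarrow> norm ((?G (0 + h) - ?G 0) / h - 0) < \<epsilon>"
      using \<delta> K by (intro exI[of _ "\<delta> / (K + 1)"]) auto
  qed
  then have "(?G has_real_derivative 0) (at 0)" by (simp add: DERIV_def)
  with deriv show ?thesis by (rule DERIV_unique)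
qed

lemma norm_fraction_line_diff_le:
  fixes A B u v :: complex
  assumes "A \<noteq> 0" and u: "cmod u \<le> C * cmod A" and t: "\<bar>t\<bar> * C \<le> 1 / 2"
  shows "cmod ((B + of_real t * v) / (A + of_real t * u) - B / A)
    \<le> \<bar>t\<bar> * (2 * cmod ((v * A - B * u) / A\<^sup>2))"
proof -
  have "\<bar>t\<bar> * cmod u \<le> (\<bar>t\<bar> * C) * cmod A"
    using u by (simp add: mult_left_mono mult.assoc)
  also have "\<dots> \<le> 1 / 2 * cmod A"
    using t by (rule mult_right_mono) simp
  finally have half: "cmod A / 2 \<le> cmod (A + of_real t * u)"
    using norm_diff_ineq[of A "of_real t * u"] by (simp add: norm_mult)
  with \<open>A \<noteq> 0\<close> have nz: "A + of_real t * u \<noteq> 0" by auto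
  have "(B + of_real t * v) / (A + of_real t * u) - B / A
      = of_real t * (v * A - B * u) / (A * (A + of_real t * u))"
    using \<open>A \<noteq> 0\<close> nz by (simp add: diff_frac_eq algebra_simps)
  also have "cmod \<dots> = \<bar>t\<bar> * cmod (v * A - B * u) / (cmod A * cmod (A + of_real t * u))"
    by (simp add: norm_divide norm_mult)
  also have "\<dots> \<le> \<bar>t\<bar> * cmod (v * A - B * u) / (cmod A * (cmod A / 2))"
    using \<open>A \<noteq> 0\<close> nz half by (intro divide_left_mono mult_left_mono mult_pos_pos) auto
  also have "\<dots> = \<bar>t\<bar> * (2 * cmod ((v * A - B * u) / A\<^sup>2))"
    by (simp add: norm_divide norm_mult power2_eq_square)
  finally show ?thesis .
qed

lemma has_vector_derivative_fraction_line:
  fixes A B u v :: complex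
  assumes "A \<noteq> 0"
  shows "((\<lambda>t. (B + of_real t * v) / (A + of_real t * u))
    has_vector_derivative (v * A - B * u) / A\<^sup>2) (at 0)"
proof -
  have "((\<lambda>z. (B + z * v) / (A + z * u))
      has_field_derivative (v * A - B * u) / A\<^sup>2) (at (of_real 0))"
    using assms by (auto intro!: derivative_eq_intros simp: power2_eq_square)
  then show ?thesis by (rule has_vector_derivative_real_field)
qed

lemma rat_at_iw_line:
  "rat_at_iw (b + Polynomial.smult t \<beta>) (a + Polynomial.smult t \<alpha>) w
    = (poly (cpoly b) (\<i> * of_real w) + of_real t * poly (cpoly \<beta>) (\<i> * of_real w))
      / (poly (cpoly a) (\<i> * of_real w) + of_real t * poly (cpoly \<alpha>) (\<i> * of_real w))"
  by (simp add: rat_at_iw_def hom_distribs)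

lemma rat_at_iw_line_velocity:
  "rat_at_iw (\<beta> * a - b * \<alpha>) (a\<^sup>2) w
    = (poly (cpoly \<beta>) (\<i> * of_real w) * poly (cpoly a) (\<i> * of_real w)
        - poly (cpoly b) (\<i> * of_real w) * poly (cpoly \<alpha>) (\<i> * of_real w))
      / (poly (cpoly a) (\<i> * of_real w))\<^sup>2"
  by (simp add: rat_at_iw_def cpoly.hom_minus cpoly.hom_mult cpoly.hom_power)

lemma has_vector_derivative_rat_at_iw_line:
  assumes "hurwitz a"
  shows "((\<lambda>t. rat_at_iw (b + Polynomial.smult t \<beta>) (a + Polynomial.smult t \<alpha>) w)
    has_vector_derivative rat_at_iw (\<beta> * a - b * \<alpha>) (a\<^sup>2) w) (at 0)"
  unfolding rat_at_iw_line rat_at_iw_line_velocity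
  by (rule has_vector_derivative_fraction_line, rule hurwitz_poly_nonzero[OF assms]) simp

lemma norm_rat_at_iw_line_diff_le:
  assumes a: "hurwitz a" and \<alpha>: "degree \<alpha> \<le> degree a"
  obtains r where "0 < r" "\<And>t w. \<bar>t\<bar> < r \<Longrightarrow>
    cmod (rat_at_iw (b + Polynomial.smult t \<beta>) (a + Polynomial.smult t \<alpha>) w - rat_at_iw b a w)
      \<le> \<bar>t\<bar> * (2 * cmod (rat_at_iw (\<beta> * a - b * \<alpha>) (a\<^sup>2) w))"
proof -
  obtain C where C: "\<And>s. 0 \<le> Re s \<Longrightarrow> cmod (poly (cpoly \<alpha>) s) \<le> C * cmod (poly (cpoly a) s)"
    using poly_bounded_by_poly_on_closed[of "{s. 0 \<le> Re s}" "cpoly a" "cpoly \<alpha>"]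
      closed_halfspace_Re_ge hurwitz_poly_nonzero[OF a] \<alpha> by auto
  show ?thesis
  proof (rule that)
    show "0 < 1 / (2 * (\<bar>C\<bar> + 1))" by simp
    fix t w :: real assume t: "\<bar>t\<bar> < 1 / (2 * (\<bar>C\<bar> + 1))"
    have "\<bar>t\<bar> * C \<le> \<bar>t\<bar> * (\<bar>C\<bar> + 1)" by (intro mult_left_mono) auto
    also have "\<dots> \<le> 1 / 2" using t by (simp add: pos_less_divide_eq algebra_simps)
    finally have "\<bar>t\<bar> * C \<le> 1 / 2" .
    then show "cmod (rat_at_iw (b + Polynomial.smult t \<beta>) (a + Polynomial.smult t \<alpha>) w
          - rat_at_iw b a w)
        \<le> \<bar>t\<bar> * (2 * cmod (rat_at_iw (\<beta> * a - b * \<alpha>) (a\<^sup>2) w))"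
      unfolding rat_at_iw_line rat_at_iw_line_velocity rat_at_iw_def[of b]
      by (intro norm_fraction_line_diff_le[OF _ C] hurwitz_poly_nonzero[OF a]) auto
  qed
qed

lemma has_real_derivative_H2_err_sq_line:
  assumes d: "hurwitz d" and e: "degree e < degree d"
    and a: "hurwitz a" and b: "degree b < degree a"
    and \<alpha>: "degree \<alpha> \<le> degree a" and \<beta>: "degree \<beta> < degree a"
  shows "((\<lambda>t. H2_err_sq e d (b + Polynomial.smult t \<beta>) (a + Polynomial.smult t \<alpha>))
    has_real_derivative - (1 / pi) * (LINT w|lborel.
      (rat_at_iw e d w - rat_at_iw b a w) \<bullet> rat_at_iw (\<beta> * a - b * \<alpha>) (a\<^sup>2) w)) (at 0)"
proof -
  let ?t = "\<lambda>t. rat_at_iw (b + Polynomial.smult t \<beta>) (a + Polynomial.smult t \<alpha>)"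
  let ?v = "rat_at_iw (\<beta> * a - b * \<alpha>) (a\<^sup>2)"
  obtain r where r: "0 < r"
      "\<And>t w. \<bar>t\<bar> < r \<Longrightarrow> cmod (?t t w - rat_at_iw b a w) \<le> \<bar>t\<bar> * (2 * cmod (?v w))"
    using norm_rat_at_iw_line_diff_le[OF a \<alpha>] by blast
  have "degree (\<beta> * a - b * \<alpha>) < degree (a\<^sup>2)"
    using degree_mult_le[of \<beta> a] degree_mult_le[of b \<alpha>] \<alpha> \<beta> b
    by (intro degree_diff_less) (simp_all add: degree_power_eq hurwitz_nonzero[OF a])
  then have v: "square_integrable lborel ?v"
    using a by (intro square_integrable_rat_at_iw hurwitz_power)
  have "((\<lambda>t. LINT w|lborel. (cmod (rat_at_iw e d w - ?t t w))\<^sup>2) has_real_derivative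
      2 * (LINT w|lborel. (rat_at_iw e d w - ?t 0 w) \<bullet> (- ?v w))) (at 0)"
  proof (rule has_real_derivative_L2_norm_squared)
    show "square_integrable lborel (\<lambda>w. rat_at_iw e d w - ?t 0 w)"
      using d e a b by (simp add: square_integrable_diff square_integrable_rat_at_iw)
    show "square_integrable lborel (\<lambda>w. 2 * cmod (?v w))"
      using v by (simp add: square_integrable_def power_mult_distrib)
    show "((\<lambda>t. rat_at_iw e d w - ?t t w) has_vector_derivative - ?v w) (at 0)" for w
      using has_vector_derivative_diff[OF has_vector_derivative_const
          has_vector_derivative_rat_at_iw_line[OF a]] by simp
    show "cmod (rat_at_iw e d w - ?t t w - (rat_at_iw e d w - ?t 0 w))
        \<le> \<bar>t - 0\<bar> * (2 * cmod (?v w))"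
      if "\<bar>t - 0\<bar> < r" for t w
      using r(2)[of t w] that by (simp add: norm_minus_commute)
    show "(\<lambda>w. rat_at_iw e d w - ?t t w) \<in> borel_measurable lborel"
      and "(\<lambda>w. - ?v w) \<in> borel_measurable lborel" for t
      by measurable
  qed (rule r(1))
  from DERIV_cmult[OF this, of "1 / (2 * pi)"] show ?thesis
    by (simp add: H2_err_sq_def)
qed

lemma critical_point_error_orthogonal:
  assumes crit: "critical_point (H2_err_sq e d) n b a"
    and d: "hurwitz d" and e: "degree e < degree d" and p: "degree p < 2 * n"
  shows "(LINT w|lborel. (rat_at_iw e d w - rat_at_iw b a w) \<bullet> rat_at_iw p (a\<^sup>2) w) = 0"
proof -
  have a: "degree a = n" "hurwitz a" and b: "degree b < n" and cop: "coprime a b"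
    using crit by (auto simp: critical_point_def SigmaS_def)
  obtain x y where xy: "p = x * a + y * b" "degree x < n" "degree y < n"
    using coprime_poly_decomposition[OF cop, of n p] a b p by auto
  have "- (1 / pi) * (LINT w|lborel. (rat_at_iw e d w - rat_at_iw b a w)
      \<bullet> rat_at_iw (x * a - b * (- y)) (a\<^sup>2) w) = 0"
  proof (rule critical_point_directional_derivative_eq_0[OF crit])
    show "degree (- y) < n" "degree x < n" using xy by auto
  qed (rule has_real_derivative_H2_err_sq_line, use a b d e xy in auto)
  then show ?thesis by (simp add: xy(1) mult.commute)
qed

lemma rat_at_iw_diff:
  assumes "hurwitz d" and "hurwitz a"
  shows "rat_at_iw e d w - rat_at_iw b a w = rat_at_iw (e * a - b * d) (d * a) w"
  using hurwitz_poly_nonzero[OF assms(1), of "\<i> * of_real w"]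
    hurwitz_poly_nonzero[OF assms(2), of "\<i> * of_real w"]
  by (simp add: rat_at_iw_def hom_distribs cpoly.hom_mult diff_frac_eq)

lemma rat_at_iw_mult_cnj_decomposition:
  assumes d: "hurwitz d" and a: "hurwitz a"
    and eq: "r * a\<^sup>2 = h * (mirror_poly a)\<^sup>2 + p * (d * a)"
  shows "rat_at_iw r (d * a) w * cnj (rat_at_iw p (a\<^sup>2) w)
    = of_real ((cmod (rat_at_iw p (a\<^sup>2) w))\<^sup>2) + rat_at_iw (h * mirror_poly p) (d * a ^ 3) w"
proof -
  define z where "z = \<i> * complex_of_real w"
  define A D R P H where "A = poly (cpoly a) z" and "D = poly (cpoly d) z"
    and "R = poly (cpoly r) z" and "P = poly (cpoly p) z" and "H = poly (cpoly h) z"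
  note defs = A_def D_def R_def P_def H_def z_def
  have nz: "A \<noteq> 0" "D \<noteq> 0"
    unfolding defs by (rule hurwitz_poly_nonzero[OF a], simp, rule hurwitz_poly_nonzero[OF d], simp)
  have "poly (cpoly (r * a\<^sup>2)) z = poly (cpoly (h * (mirror_poly a)\<^sup>2 + p * (d * a))) z"
    by (simp only: eq)
  then have R: "R * A\<^sup>2 = H * (cnj A)\<^sup>2 + P * (D * A)"
    by (simp add: defs cpoly.hom_mult cpoly.hom_add cpoly.hom_power poly_cpoly_mirror_iw
        del: of_real_hom.map_poly_pcompose)
  have "R / (D * A) = R * A\<^sup>2 / (D * A ^ 3)"
    using nz by (simp add: power2_eq_square power3_eq_cube)
  also have "\<dots> = H * (cnj A)\<^sup>2 / (D * A ^ 3) + P / A\<^sup>2"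
    unfolding R using nz by (simp add: add_divide_distrib power2_eq_square power3_eq_cube)
  finally have "R / (D * A) * cnj (P / A\<^sup>2)
      = (H * (cnj A)\<^sup>2 / (D * A ^ 3) + P / A\<^sup>2) * cnj (P / A\<^sup>2)"
    by simp
  also have "\<dots> = P / A\<^sup>2 * cnj (P / A\<^sup>2) + H * cnj P / (D * A ^ 3)"
    using nz by (simp add: distrib_right add_divide_distrib)
  also have "P / A\<^sup>2 * cnj (P / A\<^sup>2) = of_real ((cmod (P / A\<^sup>2))\<^sup>2)"
    by (rule complex_norm_square[symmetric])
  finally show ?thesis
    by (simp add: rat_at_iw_def cpoly.hom_mult cpoly.hom_power poly_cpoly_mirror_iw defs
        del: of_real_hom.map_poly_pcompose)
qed

lemma hurwitz_numerator_decomposition: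
  assumes a: "hurwitz a" and d: "hurwitz d" and "0 < degree a"
    and r: "degree r < degree d + degree a"
  obtains h p where "r * a\<^sup>2 = h * (mirror_poly a)\<^sup>2 + p * (d * a)"
    "degree h < degree d + degree a" "degree p < 2 * degree a"
proof -
  have nz: "a \<noteq> 0" "d \<noteq> 0" using a d hurwitz_nonzero by blast+
  then have deg_m: "degree ((mirror_poly a)\<^sup>2) = 2 * degree a"
    by (subst degree_power_eq) (auto dest: pcompose_eq_0 simp: degree_mirror_poly)
  have cop: "coprime ((mirror_poly a)\<^sup>2) (d * a)"
    using coprime_hurwitz_mirror[OF a hurwitz_mult[OF d a]] by simp
  have "degree (r * a\<^sup>2) < degree ((mirror_poly a)\<^sup>2) + (degree d + degree a)"
    using degree_mult_le[of r "a\<^sup>2"] nz r by (simp add: deg_m degree_power_eq)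
  then obtain h p where "r * a\<^sup>2 = h * (mirror_poly a)\<^sup>2 + p * (d * a)"
      "degree h < degree d + degree a" "degree p < degree ((mirror_poly a)\<^sup>2)"
    by (rule coprime_poly_decomposition[OF cop _ _ degree_mult_le, rotated 2])
      (use assms(3) deg_m in auto)
  then show ?thesis by (intro that) (simp_all only: deg_m)
qed

lemma critical_point_mirror_squared_dvd:
  assumes crit: "critical_point (H2_err_sq e d) n b a"
    and d: "hurwitz d" and e: "degree e < degree d"
  shows "(mirror_poly a)\<^sup>2 dvd e * a - b * d"
proof -
  have a: "degree a = n" "hurwitz a" and b: "degree b < n"
    using crit by (auto simp: critical_point_def SigmaS_def)
  have nz: "a \<noteq> 0" "d \<noteq> 0" using a d hurwitz_nonzero by blast+
  define r where "r = e * a - b * d"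
  have "degree r < degree d + degree a"
    unfolding r_def using degree_mult_le[of e a] degree_mult_le[of b d] e a b
    by (intro degree_diff_less) linarith+
  then obtain h p where hp: "r * a\<^sup>2 = h * (mirror_poly a)\<^sup>2 + p * (d * a)"
    and deg: "degree h < degree d + degree a" "degree p < 2 * degree a"
    using hurwitz_numerator_decomposition[OF a(2) d] a(1) b by (metis gr_implies_not0 neq0_conv)
  let ?P = "rat_at_iw p (a\<^sup>2)" and ?Q = "rat_at_iw (h * mirror_poly p) (d * a ^ 3)"
  have P: "hurwitz (a\<^sup>2)" "degree p < degree (a\<^sup>2)"
    using a deg nz by (simp_all add: hurwitz_power degree_power_eq)
  have "degree (h * mirror_poly p) + 2 \<le> degree (d * a ^ 3)"
    using degree_mult_le[of h "mirror_poly p"] deg nz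
    by (simp add: degree_mult_eq degree_power_eq degree_mirror_poly)
  then have Q: "integrable lborel ?Q" "(LINT w|lborel. ?Q w) = 0"
    using a d by (auto intro!: integral_rat_at_iw_eq_0 hurwitz_mult hurwitz_power)
  have split: "(rat_at_iw e d w - rat_at_iw b a w) \<bullet> ?P w = (cmod (?P w))\<^sup>2 + Re (?Q w)" for w
    using rat_at_iw_mult_cnj_decomposition[OF d a(2) hp, of w]
    by (simp add: rat_at_iw_diff[OF d a(2)] r_def complex_eq_iff inner_complex_def)
  have "0 = (LINT w|lborel. (cmod (?P w))\<^sup>2 + Re (?Q w))"
    using critical_point_error_orthogonal[OF crit d e, of p] deg(2) a(1) by (simp add: split)
  also have "\<dots> = (LINT w|lborel. (cmod (?P w))\<^sup>2)"
    using square_integrable_rat_at_iw[OF P] Q by (simp add: square_integrable_def)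
  finally have "p = 0"
    using rat_at_iw_L2_norm_eq_0D[OF P] by simp
  then have "(mirror_poly a)\<^sup>2 dvd r * a\<^sup>2" using hp by simp
  moreover have "coprime ((mirror_poly a)\<^sup>2) (a\<^sup>2)"
    using coprime_hurwitz_mirror[OF a(2) a(2)] by simp
  ultimately show ?thesis
    unfolding r_def[symmetric] using coprime_dvd_mult_left_iff by blast
qed

lemma critical_point_equation:
  assumes crit: "critical_point (H2_err_sq e d) n b a"
    and d: "hurwitz d" "degree d = Suc n" and e: "degree e \<le> n" and cop: "coprime e d"
  obtains q\<^sub>0 where "q\<^sub>0 \<noteq> 0" "b * d = e * a - Polynomial.smult q\<^sub>0 ((mirror_poly a)\<^sup>2)"
proof -
  have a: "degree a = n" "hurwitz a" and b: "degree b < n"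
    using crit by (auto simp: critical_point_def SigmaS_def)
  have nz: "a \<noteq> 0" "(mirror_poly a)\<^sup>2 \<noteq> 0"
    using hurwitz_nonzero[OF a(2)] by (auto dest: pcompose_eq_0)
  obtain q where q: "e * a - b * d = q * (mirror_poly a)\<^sup>2"
    using critical_point_mirror_squared_dvd[OF crit d(1)] d(2) e
    by (metis dvdE le_imp_less_Suc mult.commute)
  have "q \<noteq> 0"
  proof
    assume "q = 0"
    then have "d dvd e * a" using q by (metis dvd_triv_right eq_iff_diff_eq_0 mult_zero_left)
    then have "d dvd a" using cop by (metis coprime_commute coprime_dvd_mult_right_iff)
    then show False using dvd_imp_degree_le[of d a] nz a d by simp
  qed
  have "degree (e * a - b * d) \<le> 2 * n"
    using degree_mult_le[of e a] degree_mult_le[of b d] e a b d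
    by (intro degree_diff_le) linarith+
  then have "degree q + 2 * n \<le> 2 * n"
    unfolding q degree_mult_eq[OF \<open>q \<noteq> 0\<close> nz(2)]
    using nz a by (simp add: degree_power_eq degree_mirror_poly)
  then obtain q\<^sub>0 where "q = [:q\<^sub>0:]" by (auto elim: degree_eq_zeroE)
  with q \<open>q \<noteq> 0\<close> show ?thesis by (intro that[of q\<^sub>0]) (auto simp: algebra_simps)
qed

section \<open>Square-free monomials on the solutions of a quadratic system\<close>

lemma homogeneous_system_nontrivial_solution:
  fixes c :: "'t \<Rightarrow> 'p \<Rightarrow> 'a::field"
  assumes "finite A" and "finite S" and "card A < card S"
  shows "\<exists>u. (\<exists>x\<in>S. u x \<noteq> 0) \<and> (\<forall>T\<in>A. (\<Sum>x\<in>S. u x * c T x) = 0)"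
  using assms
proof (induction A arbitrary: S c rule: finite_induct)
  case empty
  then have "S \<noteq> {}" by auto
  then show ?case by (intro exI[of _ "\<lambda>_. 1"]) auto
next
  case (insert T\<^sub>0 A)
  show ?case
  proof (cases "\<forall>x\<in>S. c T\<^sub>0 x = 0")
    case True
    then show ?thesis using insert.IH[of S c] insert.prems insert.hyps by auto
  next
    case False
    then obtain z where z: "z \<in> S" "c T\<^sub>0 z \<noteq> 0" by blast
    let ?c = "\<lambda>T x. c T x - c T\<^sub>0 x / c T\<^sub>0 z * c T z"
    have "card A < card (S - {z})"
      using insert.prems insert.hyps z(1) by simp
    then obtain v where v: "\<exists>x\<in>S - {z}. v x \<noteq> 0"
        and v_sum: "\<And>T. T \<in> A \<Longrightarrow> (\<Sum>x\<in>S - {z}. v x * ?c T x) = 0"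
      using insert.IH[of "S - {z}" ?c] insert.prems(1) by auto
    define v\<^sub>z where "v\<^sub>z = - (\<Sum>x\<in>S - {z}. v x * c T\<^sub>0 x) / c T\<^sub>0 z"
    have sum_eq: "(\<Sum>x\<in>S. (v(z := v\<^sub>z)) x * c T x) = (\<Sum>x\<in>S - {z}. v x * ?c T x)" for T
    proof -
      have "(\<Sum>x\<in>S. (v(z := v\<^sub>z)) x * c T x) = v\<^sub>z * c T z + (\<Sum>x\<in>S - {z}. v x * c T x)"
        by (subst sum.remove[OF insert.prems(1) z(1)]) (auto intro!: sum.cong)
      also have "\<dots> = (\<Sum>x\<in>S - {z}. v x * ?c T x)"
        by (simp add: v\<^sub>z_def sum_subtractf right_diff_distrib sum_distrib_right
              sum_divide_distrib mult.assoc)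
      finally show ?thesis .
    qed
    moreover have "(\<Sum>x\<in>S - {z}. v x * ?c T\<^sub>0 x) = 0"
      using z(2) by simp
    ultimately have "\<forall>T\<in>insert T\<^sub>0 A. (\<Sum>x\<in>S. (v(z := v\<^sub>z)) x * c T x) = 0"
      using v_sum by auto
    moreover have "\<exists>x\<in>S. (v(z := v\<^sub>z)) x \<noteq> 0"
      using v by auto
    ultimately show ?thesis by blast
  qed
qed

definition monomial_relation :: "'i set \<Rightarrow> ('i \<Rightarrow> 'p \<Rightarrow> 'a::field) \<Rightarrow> 'p set \<Rightarrow> ('p \<Rightarrow> 'a) \<Rightarrow> bool" where
  "monomial_relation I X S u \<longleftrightarrow> (\<forall>T\<subseteq>I. (\<Sum>x\<in>S. u x * (\<Prod>i\<in>T. X i x)) = 0)"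

text \<open>A factor occurring twice is replaced by an affine form, which lowers the degree.\<close>

lemma mult_squarefree_monomial_reduce:
  fixes x :: "'i \<Rightarrow> 'a::comm_ring_1"
  assumes "finite T" and "i \<in> T" and quad: "(x i)\<^sup>2 = c + (\<Sum>k\<in>I. M k * x k)"
  shows "x i * (\<Prod>j\<in>T. x j)
    = c * (\<Prod>j\<in>T - {i}. x j) + (\<Sum>k\<in>I. M k * (x k * (\<Prod>j\<in>T - {i}. x j)))"
proof -
  have "x i * (\<Prod>j\<in>T. x j) = (x i)\<^sup>2 * (\<Prod>j\<in>T - {i}. x j)"
    using prod.remove[OF assms(1,2), of x] by (simp add: power2_eq_square mult.assoc)
  then show ?thesis
    by (simp add: quad distrib_right sum_distrib_right mult.assoc)
qed

lemma monomial_relation_mult_coordinate: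
  assumes I: "finite I"
    and quad: "\<And>x i. x \<in> S \<Longrightarrow> i \<in> I \<Longrightarrow> (X i x)\<^sup>2 = c i + (\<Sum>j\<in>I. M i j * X j x)"
    and rel: "monomial_relation I X S u" and i: "i \<in> I"
  shows "monomial_relation I X S (\<lambda>x. u x * X i x)"
proof -
  have "(\<Sum>x\<in>S. u x * (X i x * (\<Prod>j\<in>T. X j x))) = 0" if "i \<in> I" "T \<subseteq> I" for i T
    using that
  proof (induction "card T" arbitrary: i T rule: less_induct)
    case less
    have fin_T: "finite T" using less.prems(2) I finite_subset by blast
    have zero: "(\<Sum>x\<in>S. u x * (\<Prod>j\<in>T. X j x)) = 0" if "T \<subseteq> I" for T
      using rel that by (simp add: monomial_relation_def)
    show ?case
    proof (cases "i \<in> T")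
      case False
      then show ?thesis
        using zero[of "insert i T"] less.prems fin_T by simp
    next
      case True
      define m where "m = (\<lambda>x. \<Prod>j\<in>T - {i}. X j x)"
      have smaller: "T - {i} \<subseteq> I" "card (T - {i}) < card T"
        using less.prems(2) card_Diff1_less[OF fin_T True] by auto
      have "X i x * (\<Prod>j\<in>T. X j x) = c i * m x + (\<Sum>k\<in>I. M i k * (X k x * m x))" if "x \<in> S" for x
        unfolding m_def
        by (rule mult_squarefree_monomial_reduce[OF fin_T True quad[OF that less.prems(1)]])
      then have "(\<Sum>x\<in>S. u x * (X i x * (\<Prod>j\<in>T. X j x)))
          = (\<Sum>x\<in>S. c i * (u x * m x) + (\<Sum>k\<in>I. M i k * (u x * (X k x * m x))))"
        by (simp add: distrib_left sum_distrib_left mult_ac)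
      also have "\<dots> = c i * (\<Sum>x\<in>S. u x * m x) + (\<Sum>k\<in>I. M i k * (\<Sum>x\<in>S. u x * (X k x * m x)))"
        by (simp add: sum.distrib sum.swap[of _ I] flip: sum_distrib_left)
      also have "\<dots> = 0"
        using zero[OF smaller(1)] less.hyps[OF smaller(2) _ smaller(1)] by (simp add: m_def)
      finally show ?thesis .
    qed
  qed
  with i show ?thesis by (simp add: monomial_relation_def mult.assoc)
qed

lemma monomial_relation_trivial:
  assumes I: "finite I" and S: "finite S"
    and quad: "\<And>x i. x \<in> S \<Longrightarrow> i \<in> I \<Longrightarrow> (X i x)\<^sup>2 = c i + (\<Sum>j\<in>I. M i j * X j x)"
    and sep: "\<And>x y. x \<in> S \<Longrightarrow> y \<in> S \<Longrightarrow> x \<noteq> y \<Longrightarrow> \<exists>i\<in>I. X i x \<noteq> X i y"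
    and rel: "monomial_relation I X S u" and y: "y \<in> S"
  shows "u y = 0"
proof (rule ccontr)
  assume "u y \<noteq> 0"
  have "\<exists>v. monomial_relation I X S v \<and> v y \<noteq> 0 \<and> (\<forall>x\<in>R. v x = 0)" if "R \<subseteq> S - {y}" for R
    using finite_subset[OF that finite_Diff[OF S]] that
  proof (induction R rule: finite_induct)
    case empty
    show ?case using rel \<open>u y \<noteq> 0\<close> by auto
  next
    case (insert z R)
    then obtain v where v: "monomial_relation I X S v" "v y \<noteq> 0" "\<forall>x\<in>R. v x = 0" by auto
    obtain i where i: "i \<in> I" "X i y \<noteq> X i z"
      using sep[of y z] insert.prems y by auto
    define w where "w = (\<lambda>x. v x * X i x - X i z * v x)"
    have "monomial_relation I X S w"
      using v(1) monomial_relation_mult_coordinate[OF I quad v(1) i(1)]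
      by (simp add: monomial_relation_def w_def left_diff_distrib sum_subtractf mult.assoc
          flip: sum_distrib_left)
    moreover have "w y \<noteq> 0" "\<forall>x\<in>insert z R. w x = 0"
      using v(2,3) i(2) by (auto simp: w_def)
    ultimately show ?case by blast
  qed
  then obtain v where v: "monomial_relation I X S v" "v y \<noteq> 0" "\<forall>x\<in>S - {y}. v x = 0" by blast
  have "0 = (\<Sum>x\<in>S. v x)"
    using v(1) by (auto simp: monomial_relation_def dest: spec[of _ "{}"])
  also have "\<dots> = v y"
    using v(3) S y by (simp add: sum.remove)
  finally show False using v(2) by simp
qed

theorem card_quadratic_system_solutions_le:
  fixes X :: "'i \<Rightarrow> 'p \<Rightarrow> 'a::field"
  assumes "finite I" and "finite S"
    and "\<And>x i. x \<in> S \<Longrightarrow> i \<in> I \<Longrightarrow> (X i x)\<^sup>2 = c i + (\<Sum>j\<in>I. M i j * X j x)"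
    and "\<And>x y. x \<in> S \<Longrightarrow> y \<in> S \<Longrightarrow> x \<noteq> y \<Longrightarrow> \<exists>i\<in>I. X i x \<noteq> X i y"
  shows "card S \<le> 2 ^ card I"
proof (rule ccontr)
  assume "\<not> card S \<le> 2 ^ card I"
  then have "card (Pow I) < card S" using assms(1) by (simp add: card_Pow)
  then obtain u where "\<exists>x\<in>S. u x \<noteq> 0" and "monomial_relation I X S u"
    using homogeneous_system_nontrivial_solution[of "Pow I" S "\<lambda>T x. \<Prod>i\<in>T. X i x"] assms(1,2)
    unfolding monomial_relation_def by auto
  with monomial_relation_trivial[of I S X c M u] assms show False by blast
qed

section \<open>The system defining Xi\<close>

definition poly_values :: "nat \<Rightarrow> (nat \<Rightarrow> 'a::comm_semiring_0) \<Rightarrow> 'a poly \<Rightarrow> 'a vec" where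
  "poly_values N x p = vec N (\<lambda>i. poly p (x i))"

lemma poly_values_carrier [simp]: "poly_values N x p \<in> carrier_vec N"
  by (simp add: poly_values_def)

lemma poly_values_index [simp]: "i < N \<Longrightarrow> poly_values N x p $ i = poly p (x i)"
  by (simp add: poly_values_def)

lemma poly_values_inject:
  fixes p q :: "'a::idom poly"
  assumes "inj_on x {..<N}" and "degree p < N" and "degree q < N"
    and eq: "poly_values N x p = poly_values N x q"
  shows "p = q"
proof (rule poly_eqI_degree[of "x ` {..<N}"])
  show "poly p z = poly q z" if "z \<in> x ` {..<N}" for z
    using that eq by (metis imageE lessThan_iff poly_values_index)
qed (use assms in \<open>auto simp: card_image\<close>)

lemma vandermonde_carrier: "vandermonde N x \<in> carrier_mat N N"
  by (simp add: vandermonde_def)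

lemma vandermonde_mult_coeffs:
  assumes "degree p < N"
  shows "vandermonde N x *\<^sub>v vec N (coeff p) = poly_values N x p"
proof (rule eq_vecI)
  fix i assume "i < dim_vec (poly_values N x p)"
  then have i: "i < N" by (simp add: poly_values_def)
  have "poly p (x i) = (\<Sum>j\<in>{0..<N}. x i ^ j * coeff p j)"
    unfolding poly_altdef
    by (rule sum.mono_neutral_cong_left) (use assms in \<open>auto simp: coeff_eq_0\<close>)
  then show "(vandermonde N x *\<^sub>v vec N (coeff p)) $ i = poly_values N x p $ i"
    using i by (simp add: vandermonde_def scalar_prod_def)
qed (simp add: vandermonde_def poly_values_def)

lemma det_vandermonde_nonzero:
  assumes "inj_on x {..<N}"
  shows "det (vandermonde N x) \<noteq> 0"
proof
  assume "det (vandermonde N x) = 0"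
  then obtain v where v: "v \<in> carrier_vec N" "v \<noteq> 0\<^sub>v N" "vandermonde N x *\<^sub>v v = 0\<^sub>v N"
    using det_0_iff_vec_prod_zero_field[OF vandermonde_carrier] by blast
  define p where "p = (\<Sum>j<N. monom (v $ j) j)"
  have N: "0 < N" using v(1,2) by (cases N) auto
  have coeff: "coeff p j = (if j < N then v $ j else 0)" for j
    by (simp add: p_def coeff_sum)
  have deg: "degree p < N"
    using N by (intro degree_lessI) (auto simp: coeff)
  have v_eq: "v = vec N (coeff p)" using v(1) by (auto simp: coeff)
  then have "poly_values N x p = poly_values N x 0"
    using v(3) vandermonde_mult_coeffs[OF deg, of x] by (auto simp: poly_values_def)
  then have "p = 0"
    using poly_values_inject[OF assms deg, of 0] N by simp
  with v(2) v_eq show False by auto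
qed

lemma mat_inverse_vandermonde:
  assumes "inj_on x {..<N}"
  obtains W where "mat_inverse (vandermonde N x) = Some W" "W \<in> carrier_mat N N"
    "W * vandermonde N x = 1\<^sub>m N"
proof -
  have "vandermonde N x \<in> Units (ring_mat TYPE(complex) N ())"
    by (rule det_non_zero_imp_unit[OF vandermonde_carrier det_vandermonde_nonzero[OF assms]])
  then obtain W where "mat_inverse (vandermonde N x) = Some W"
    using mat_inverse(1)[OF vandermonde_carrier, of N x "()"] by fastforce
  with mat_inverse(2)[OF vandermonde_carrier this] that show ?thesis by blast
qed

lemma Mmat_carrier:
  assumes "inj_on \<delta> {..<N}"
  shows "Mmat N \<delta> e \<in> carrier_mat N N"
proof -
  have "inj_on (\<lambda>i. - \<delta> i) {..<N}" using assms by (simp add: inj_on_def)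
  then obtain W where "mat_inverse (vandermonde N (\<lambda>i. - \<delta> i)) = Some W" "W \<in> carrier_mat N N"
    by (rule mat_inverse_vandermonde)
  then show ?thesis
    unfolding Mmat_def by (auto intro!: mult_carrier_mat[of _ N N] vandermonde_carrier)
qed

lemma Mmat_mult_poly_values:
  assumes inj: "inj_on \<delta> {..<N}" and deg: "degree p < N" and i: "i < N"
  shows "(Mmat N \<delta> e *\<^sub>v poly_values N (\<lambda>i. - \<delta> i) p) $ i = poly (cpoly e) (\<delta> i) * poly p (\<delta> i)"
proof -
  let ?D = "mat N N (\<lambda>(i,j). if i = j then poly (cpoly e) (\<delta> i) else 0)"
  let ?V = "vandermonde N \<delta>" and ?V' = "vandermonde N (\<lambda>i. - \<delta> i)"
  let ?c = "vec N (coeff p)"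
  have "inj_on (\<lambda>i. - \<delta> i) {..<N}" using inj by (simp add: inj_on_def)
  then obtain W where W: "mat_inverse ?V' = Some W" "W \<in> carrier_mat N N" "W * ?V' = 1\<^sub>m N"
    by (rule mat_inverse_vandermonde)
  have carrier: "?D * ?V \<in> carrier_mat N N" "?V' \<in> carrier_mat N N" "?c \<in> carrier_vec N"
    by (auto intro!: mult_carrier_mat[of _ N N] vandermonde_carrier)
  have "Mmat N \<delta> e *\<^sub>v poly_values N (\<lambda>i. - \<delta> i) p = (?D * ?V * W) *\<^sub>v (?V' *\<^sub>v ?c)"
    by (simp add: Mmat_def W(1) vandermonde_mult_coeffs[OF deg])
  also have "\<dots> = (?D * ?V) *\<^sub>v ((W * ?V') *\<^sub>v ?c)"
    using carrier W(2)
    by (simp add: assoc_mult_mat_vec[where n\<^sub>1 = N and n\<^sub>2 = N and n\<^sub>3 = N] mult_mat_vec_carrier)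
  also have "\<dots> = ?D *\<^sub>v (?V *\<^sub>v ?c)"
    using vandermonde_carrier carrier(3) W(3)
    by (simp add: assoc_mult_mat_vec[where n\<^sub>1 = N and n\<^sub>2 = N and n\<^sub>3 = N])
  also have "\<dots> = ?D *\<^sub>v poly_values N \<delta> p"
    by (simp add: vandermonde_mult_coeffs[OF deg])
  also have "\<dots> $ i = (\<Sum>j\<in>{0..<N}. (if i = j then poly (cpoly e) (\<delta> i) else 0) * poly p (\<delta> j))"
    using i by (simp add: scalar_prod_def poly_values_def)
  also have "\<dots> = poly (cpoly e) (\<delta> i) * poly p (\<delta> i)"
    using i by (simp add: if_distrib[of "\<lambda>c. c * _"] cong: if_cong)
  finally show ?thesis .
qed

lemma card_Xi:
  assumes "inj_on \<delta> {..<N}"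
  shows "finite (Xi N \<delta> e)" and "card (Xi N \<delta> e) \<le> 2 ^ N - 1"
proof -
  let ?M = "Mmat N \<delta> e" and ?S = "insert (0\<^sub>v N) (Xi N \<delta> e)"
  have M: "?M \<in> carrier_mat N N" by (rule Mmat_carrier[OF assms])
  have carrier: "x \<in> carrier_vec N" if "x \<in> ?S" for x using that by (auto simp: Xi_def)
  have system: "(x $ i)\<^sup>2 = 0 + (\<Sum>j<N. ?M $$ (i, j) * x $ j)" if "x \<in> ?S" "i < N" for x i
  proof -
    have "(x $ i)\<^sup>2 = (?M *\<^sub>v x) $ i"
      using that M by (auto simp: Xi_def)
    also have "\<dots> = (\<Sum>j<N. ?M $$ (i, j) * x $ j)"
      using that(2) M carrier[OF that(1)] by (simp add: scalar_prod_def lessThan_atLeast0)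
    finally show ?thesis by simp
  qed
  have "finite ?S \<and> card ?S \<le> 2 ^ N"
  proof (rule finite_if_finite_subsets_card_bdd)
    fix G assume G: "G \<subseteq> ?S" "finite G"
    have "card G \<le> 2 ^ card {..<N}"
    proof (rule card_quadratic_system_solutions_le[OF _ G(2)])
      show "(x $ i)\<^sup>2 = 0 + (\<Sum>j\<in>{..<N}. ?M $$ (i, j) * x $ j)" if "x \<in> G" "i \<in> {..<N}" for x i
        using system G that by blast
      show "\<exists>i\<in>{..<N}. x $ i \<noteq> y $ i" if "x \<in> G" "y \<in> G" "x \<noteq> y" for x y
        using that G carrier by (metis carrier_vecD eq_vecI lessThan_iff subsetD)
    qed simp
    then show "card G \<le> 2 ^ N" by simp
  qed
  moreover have "0\<^sub>v N \<notin> Xi N \<delta> e" by (simp add: Xi_def)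
  ultimately show "finite (Xi N \<delta> e)" "card (Xi N \<delta> e) \<le> 2 ^ N - 1" by auto
qed

lemma poly_values_in_Xi:
  assumes eq: "b * d = e * a - Polynomial.smult q\<^sub>0 ((mirror_poly a)\<^sup>2)" and "q\<^sub>0 \<noteq> 0"
    and a: "degree a < N" "a \<noteq> 0"
    and root: "\<And>i. i < N \<Longrightarrow> poly (cpoly d) (\<delta> i) = 0" and inj: "inj_on \<delta> {..<N}"
  shows "poly_values N (\<lambda>i. - \<delta> i) (cpoly (Polynomial.smult q\<^sub>0 a)) \<in> Xi N \<delta> e"
proof -
  let ?p = "cpoly (Polynomial.smult q\<^sub>0 a)" and ?v = "poly_values N (\<lambda>i. - \<delta> i)"
  have inj': "inj_on (\<lambda>i. - \<delta> i) {..<N}" using inj by (simp add: inj_on_def)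
  have deg: "degree ?p < N" and "?p \<noteq> 0" using a \<open>q\<^sub>0 \<noteq> 0\<close> by simp_all
  then have "?v ?p \<noteq> ?v 0"
    using poly_values_inject[OF inj' deg, of 0] by auto
  then have "?v ?p \<noteq> 0\<^sub>v N" by (auto simp: poly_values_def)
  moreover have "(?v ?p $ i)\<^sup>2 = (Mmat N \<delta> e *\<^sub>v ?v ?p) $ i" if i: "i < N" for i
  proof -
    have "poly (cpoly (b * d)) (\<delta> i)
        = poly (cpoly (e * a - Polynomial.smult q\<^sub>0 ((mirror_poly a)\<^sup>2))) (\<delta> i)"
      by (simp only: eq)
    then have "poly (cpoly e) (\<delta> i) * poly (cpoly a) (\<delta> i)
        = of_real q\<^sub>0 * (poly (cpoly a) (- \<delta> i))\<^sup>2"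
      using root[OF i]
      by (simp add: hom_distribs cpoly.hom_mult cpoly.hom_power poly_cpoly_mirror
          del: of_real_hom.map_poly_pcompose)
    then show ?thesis
      unfolding Mmat_mult_poly_values[OF inj deg i]
      using i by (simp add: hom_distribs power_mult_distrib power2_eq_square mult_ac)
  qed
  ultimately show ?thesis by (simp add: Xi_def)
qed

section \<open>Critical points and elements of Xi\<close>

definition Xi_parametrizes ::
  "nat \<Rightarrow> (nat \<Rightarrow> complex) \<Rightarrow> real poly \<Rightarrow> real poly \<Rightarrow> real \<Rightarrow> complex vec
    \<Rightarrow> real poly \<Rightarrow> real poly \<Rightarrow> bool" where
  "Xi_parametrizes N \<delta> d e q\<^sub>0 \<xi> b a \<longleftrightarrow> q\<^sub>0 \<noteq> 0 \<and> \<xi> \<in> Xi N \<delta> e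
    \<and> (\<forall>i<N. of_real q\<^sub>0 * poly (cpoly a) (- \<delta> i) = \<xi> $ i)
    \<and> b * d = e * a - Polynomial.smult q\<^sub>0 ((mirror_poly a)\<^sup>2)"

lemma critical_point_Xi_parametrizes:
  assumes crit: "critical_point (H2_err_sq e d) n b a"
    and d: "hurwitz d" "degree d = Suc n" "\<And>i. i < Suc n \<Longrightarrow> poly (cpoly d) (\<delta> i) = 0"
    and inj: "inj_on \<delta> {..<Suc n}" and e: "degree e \<le> n" "coprime e d"
  shows "\<exists>q\<^sub>0 \<xi>. Xi_parametrizes (Suc n) \<delta> d e q\<^sub>0 \<xi> b a"
proof -
  have a: "degree a < Suc n" "a \<noteq> 0"
    using crit by (auto simp: critical_point_def SigmaS_def)
  obtain q\<^sub>0 where q\<^sub>0: "q\<^sub>0 \<noteq> 0" "b * d = e * a - Polynomial.smult q\<^sub>0 ((mirror_poly a)\<^sup>2)"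
    using critical_point_equation[OF crit d(1,2) e] by blast
  let ?\<xi> = "poly_values (Suc n) (\<lambda>i. - \<delta> i) (cpoly (Polynomial.smult q\<^sub>0 a))"
  have "?\<xi> \<in> Xi (Suc n) \<delta> e"
    using poly_values_in_Xi[OF q\<^sub>0(2,1) a d(3) inj] .
  moreover have "of_real q\<^sub>0 * poly (cpoly a) (- \<delta> i) = ?\<xi> $ i" if "i < Suc n" for i
    using that by (simp add: hom_distribs)
  ultimately show ?thesis
    using q\<^sub>0 unfolding Xi_parametrizes_def by blast
qed

lemma Xi_parametrizes_unique_poly:
  fixes \<xi> :: "complex vec"
  assumes par: "Xi_parametrizes N \<delta> d e q\<^sub>0 \<xi> b a" and inj: "inj_on \<delta> {..<N}"
    and deg: "degree a < N" "degree p < N"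
    and interp: "\<forall>i<N. c * poly p (- \<delta> i) = \<xi> $ i"
  shows "Polynomial.smult c p = Polynomial.smult (of_real q\<^sub>0) (cpoly a)"
proof (rule poly_values_inject)
  show "inj_on (\<lambda>i. - \<delta> i) {..<N}" using inj by (simp add: inj_on_def)
  show "poly_values N (\<lambda>i. - \<delta> i) (Polynomial.smult c p)
      = poly_values N (\<lambda>i. - \<delta> i) (Polynomial.smult (of_real q\<^sub>0) (cpoly a))"
    using par interp by (intro eq_vecI) (auto simp: Xi_parametrizes_def poly_values_def)
qed (use deg in \<open>auto intro: le_less_trans[OF degree_smult_le]\<close>)

lemma Xi_parametrizes_inject:
  assumes par: "Xi_parametrizes N \<delta> d e q\<^sub>0 \<xi> b a" "Xi_parametrizes N \<delta> d e q\<^sub>1 \<xi> b' a'"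
    and inj: "inj_on \<delta> {..<N}" and "d \<noteq> 0"
    and deg: "degree a < N" "degree a' = degree a" and monic: "lead_coeff a = 1" "lead_coeff a' = 1"
  shows "b = b' \<and> a = a'"
proof -
  have "cpoly (Polynomial.smult q\<^sub>1 a') = cpoly (Polynomial.smult q\<^sub>0 a)"
    unfolding of_real_hom.map_poly_hom_smult
    by (rule Xi_parametrizes_unique_poly[OF par(1) inj])
      (use par(2) deg in \<open>auto simp: Xi_parametrizes_def\<close>)
  then have eq: "Polynomial.smult q\<^sub>1 a' = Polynomial.smult q\<^sub>0 a" by simp
  from arg_cong[OF this, of "\<lambda>p. coeff p (degree a)"] have "q\<^sub>0 = q\<^sub>1"
    using deg(2) monic by simp
  moreover have "q\<^sub>0 \<noteq> 0" using par(1) by (simp add: Xi_parametrizes_def)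
  ultimately have "a = a'" using eq by (simp add: smult_eq_iff)
  then have "b * d = b' * d"
    using par \<open>q\<^sub>0 = q\<^sub>1\<close> by (simp add: Xi_parametrizes_def)
  with \<open>a = a'\<close> \<open>d \<noteq> 0\<close> show ?thesis by simp
qed

lemma card_critical_points_le:
  assumes d: "hurwitz d" "degree d = Suc n" "\<And>i. i < Suc n \<Longrightarrow> poly (cpoly d) (\<delta> i) = 0"
    and inj: "inj_on \<delta> {..<Suc n}" and e: "degree e \<le> n" "coprime e d"
  shows "finite {(b, a). critical_point (H2_err_sq e d) n b a}" (is "finite ?C")
    and "card {(b, a). critical_point (H2_err_sq e d) n b a} \<le> 2 ^ Suc n - 1"
proof -
  let ?par = "Xi_parametrizes (Suc n) \<delta> d e"
  have "\<exists>\<xi>. \<exists>q\<^sub>0. ?par q\<^sub>0 \<xi> (fst x) (snd x)" if "x \<in> ?C" for x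
    using that critical_point_Xi_parametrizes[OF _ d inj e, of "fst x" "snd x"]
    by (simp add: case_prod_beta) blast
  then obtain f where f: "\<And>x. x \<in> ?C \<Longrightarrow> \<exists>q\<^sub>0. ?par q\<^sub>0 (f x) (fst x) (snd x)"
    by metis
  have monic: "degree (snd x) = n" "lead_coeff (snd x) = 1" if "x \<in> ?C" for x
    using that by (auto simp: critical_point_def SigmaS_def)
  have inj_f: "inj_on f ?C"
  proof (rule inj_onI)
    fix x y assume xy: "x \<in> ?C" "y \<in> ?C" "f x = f y"
    obtain q\<^sub>0 q\<^sub>1 where par: "?par q\<^sub>0 (f x) (fst x) (snd x)" "?par q\<^sub>1 (f x) (fst y) (snd y)"
      using f[OF xy(1)] f[OF xy(2)] xy(3) by auto
    have "fst x = fst y \<and> snd x = snd y"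
      by (rule Xi_parametrizes_inject[OF par inj hurwitz_nonzero[OF d(1)]])
        (use monic[OF xy(1)] monic[OF xy(2)] in simp_all)
    then show "x = y" by (simp add: prod_eq_iff)
  qed
  have f_Xi: "f ` ?C \<subseteq> Xi (Suc n) \<delta> e"
    using f by (force simp: Xi_parametrizes_def)
  show "finite ?C"
    by (rule inj_on_finite[OF inj_f f_Xi card_Xi(1)[OF inj]])
  show "card ?C \<le> 2 ^ Suc n - 1"
    using card_inj_on_le[OF inj_f f_Xi card_Xi(1)[OF inj]] card_Xi(2)[OF inj] by (rule order_trans)
qed

lemma hurwitz_of_linear_factors:
  assumes d: "cpoly d = (\<Prod>i<N. [:- \<delta> i, 1:])" and "\<forall>i<N. Re (\<delta> i) < 0"
  shows "hurwitz d" and "degree d = N" and "i < N \<Longrightarrow> poly (cpoly d) (\<delta> i) = 0"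
proof -
  have root: "poly (cpoly d) z = 0 \<longleftrightarrow> (\<exists>i<N. z = \<delta> i)" for z
    unfolding d by (auto simp: poly_prod)
  then show "hurwitz d" and "i < N \<Longrightarrow> poly (cpoly d) (\<delta> i) = 0"
    using assms(2) by (auto simp: hurwitz_def)
  have "degree (cpoly d) = N"
    unfolding d by (subst degree_prod_eq_sum_degree) auto
  then show "degree d = N" by simp
qed

theorem theorem6:
  fixes N :: nat and d e :: "real poly" and \<delta> :: "nat \<Rightarrow> complex"
  assumes N2: "N \<ge> 2"
    and d_fact: "cpoly d = (\<Prod>i<N. [:- \<delta> i, 1:])"
    and \<delta>_dist: "inj_on \<delta> {..<N}"
    and \<delta>_lhp: "\<forall>i<N. Re (\<delta> i) < 0"
    and e_deg: "degree e \<le> N - 1"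
    and e_cop: "coprime e d"
  shows "(finite {(b, a). critical_point (H2_err_sq e d) (N - 1) b a}
       \<and> card {(b, a). critical_point (H2_err_sq e d) (N - 1) b a} \<le> 2 ^ N - 1)
     \<and> (\<forall>b a. critical_point (H2_err_sq e d) (N - 1) b a \<longrightarrow>
       (\<exists>q0 :: real. \<exists>\<xi> \<in> Xi N \<delta> e.
          (\<forall>i<N. of_real q0 * poly (cpoly a) (- \<delta> i) = \<xi> $ i)
        \<and> (\<forall>p :: complex poly. degree p \<le> N - 1 \<longrightarrow>
              (\<forall>i<N. of_real q0 * poly p (- \<delta> i) = \<xi> $ i) \<longrightarrow> p = cpoly a)
        \<and> b * d = e * a - Polynomial.smult q0 ((a \<circ>\<^sub>p [:0, -1:])\<^sup>2)))"
proof (intro conjI allI impI)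
  define n where "n = N - 1"
  have N: "N = Suc n" using N2 by (simp add: n_def)
  note d = hurwitz_of_linear_factors[OF d_fact \<delta>_lhp, unfolded N]
    and inj = \<delta>_dist[unfolded N] and e = e_deg[folded n_def] e_cop
  show "finite {(b, a). critical_point (H2_err_sq e d) (N - 1) b a}"
    and "card {(b, a). critical_point (H2_err_sq e d) (N - 1) b a} \<le> 2 ^ N - 1"
    using card_critical_points_le[OF d inj e] by (simp_all add: N)
  fix b a assume crit: "critical_point (H2_err_sq e d) (N - 1) b a"
  then obtain q\<^sub>0 \<xi> where par: "Xi_parametrizes N \<delta> d e q\<^sub>0 \<xi> b a"
    using critical_point_Xi_parametrizes[OF _ d inj e, of b a] by (auto simp: N)
  have "degree a < N"
    using crit N by (auto simp: critical_point_def SigmaS_def)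
  then have "p = cpoly a" if "degree p \<le> N - 1" "\<forall>i<N. of_real q\<^sub>0 * poly p (- \<delta> i) = \<xi> $ i" for p
    using Xi_parametrizes_unique_poly[OF par \<delta>_dist _ _ that(2)] that(1) par
    by (simp add: N Xi_parametrizes_def smult_eq_iff)
  with par show "\<exists>q0. \<exists>\<xi>\<in>Xi N \<delta> e. (\<forall>i<N. of_real q0 * poly (cpoly a) (- \<delta> i) = \<xi> $ i)
      \<and> (\<forall>p. degree p \<le> N - 1 \<longrightarrow> (\<forall>i<N. of_real q0 * poly p (- \<delta> i) = \<xi> $ i) \<longrightarrow> p = cpoly a)
      \<and> b * d = e * a - Polynomial.smult q0 ((mirror_poly a)\<^sup>2)"
    unfolding Xi_parametrizes_def by (intro exI[of _ q\<^sub>0] bexI[of _ \<xi>]) simp_all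
qed

end
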